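(* Let $V_0\in\mathbb{R}$ and $K\ge V_0$, and call $R\in\mathcal{R}_b^r$ feasible if $\mathcal{V}(R)\ge V_0$ and $\int_0^1R(r)dr\le K$. For $R\in\mathcal{R}_b^r$ let $$A(R)=\int_{-\infty}^\infty y\,d\mathcal{E}(R)(y)-x_0$$ be the total effort. Then $$\sup\{A(R):R\in\mathcal{R}_b^r\text{ feasible}\}=\sqrt{\frac{(K-V_0)T}{c}}.$$ When $K=V_0$, the unique optimal reward (up to a.e. equivalence) is $R^*(r)\equiv V_0$. When $K>V_0$, set $\lambda=\sigma^2\sqrt{\frac{cT}{K-V_0}}$ and, for $M>0$, let $\mu_M$ be the probability measure on $\mathbb{R}$ with density $$f_{\mu_M}(y)=\frac{f_0(y)\exp\left(\frac{\max(\min(y,M),-M)}{\lambda}\right)}{\int_{-\infty}^\infty f_0(z)\exp\left(\frac{\max(\min(z,M),-M)}{\lambda}\right)dz},$$ and let $$R_M(r)=2c\sigma^2\ln\zeta_{\mu_M}(q_{\mu_M}(r))+V_0,\qquad\zeta_{\mu_M}=f_{\mu_M}/f_0,$$ where $q_{\mu_M}$ is the quantile function of $\mu_M$. Then, as $M\to\infty$, $R_M$ is an $O(e^{-M/\lambda})$-optimal reward, i.e. $R_M\in\mathcal{R}_b^r$ is feasible for all sufficiently large $M$ and $$A(R_M)=\sqrt{\frac{(K-V_0)T}{c}}+O(e^{-M/\lambda})\quad\text{as }M\to\infty.$$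
   Context: Fix constants $T,\sigma,c>0$ and $x_0\in\mathbb{R}$. Let $f_0$ be the density of $\mathcal{N}(x_0,\sigma^2T)$. $\mathcal{R}_b^r$ is the set of bounded (weakly) increasing functions $R:[0,1]\to\mathbb{R}$ (bounded purely rank-based rewards); at $r=0,1$ the function $R_M$ is defined by its limits. Game: let $\Omega=C([0,T],\mathbb{R})$ with canonical process $X$, and let $P$ be the law on $\Omega$ of $(x_0+\sigma B_t)_{t\in[0,T]}$, $B$ a standard Brownian motion started at $0$. Let $\mathcal{Q}=\{Q\in\mathcal{P}(\Omega):Q\sim P\}$ (mutually absolutely continuous), and write $Q_T$ for the law of $X_T$ under $Q$. With $H(Q|P)=E^Q[\ln(dQ/dP)]$ the relative entropy and $F_{\tilde\mu}$ the c.d.f. of $\tilde\mu\in\mathcal{P}(\mathbb{R})$, put $$V(R,\tilde\mu):=\sup_{Q\in\mathcal{Q}}\left\{E^Q\left[R(F_{\tilde\mu}(X_T))\right]-2c\sigma^2H(Q|P)\right\}.$$ A probability measure $\mu$ on $\mathbb{R}$ is an equilibrium for $R$ if $\mu=Q_T$ for some $Q\in\mathcal{Q}$ attaining the supremum $V(R,\mu)$. Each $R\in\mathcal{R}_b^r$ has exactly one equilibrium, denoted $\mathcal{E}(R)$ (it has finite mean), and the game value is $\mathcal{V}(R):=V(R,\mathcal{E}(R))$. *)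

theory Defs
  imports "HOL-Probability.Probability" "HOL-Library.Landau_Symbols"
begin

text \<open>
  \<open>C([0,T], \<real>)\<close> is represented by the extensional functions on \<open>{0..T}\<close> that are continuous there.
  The \<open>\<sigma>\<close>-algebra is generated by the coordinate maps; on this space it coincides with the Borel
  \<open>\<sigma>\<close>-algebra of the supremum norm. The canonical process is \<open>X\<^sub>t \<omega> = \<omega> t\<close>.
\<close>

definition path_space :: "real \<Rightarrow> (real \<Rightarrow> real) measure" where
  "path_space T =
     restrict_space (\<Pi>\<^sub>M t\<in>{0..T}. (borel :: real measure)) {\<omega>. continuous_on {0..T} \<omega>}"

definition std_brownian_motion :: "'w measure \<Rightarrow> real \<Rightarrow> (real \<Rightarrow> 'w \<Rightarrow> real) \<Rightarrow> bool" where
  "std_brownian_motion W T B \<longleftrightarrow>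
     prob_space W \<and>
     (\<forall>t\<in>{0..T}. B t \<in> borel_measurable W) \<and>
     (\<forall>w\<in>space W. B 0 w = 0) \<and>
     (\<forall>w\<in>space W. continuous_on {0..T} (\<lambda>t. B t w)) \<and>
     (\<forall>s\<in>{0..T}. \<forall>t\<in>{0..T}. s < t \<longrightarrow>
        distributed W lborel (\<lambda>w. B t w - B s w) (\<lambda>y. ennreal (normal_density 0 (sqrt (t - s)) y))) \<and>
     (\<forall>(n::nat) (\<tau>::nat \<Rightarrow> real). mono_on {..n} \<tau> \<and> \<tau> ` {..n} \<subseteq> {0..T} \<longrightarrow>
        prob_space.indep_vars W (\<lambda>_. borel) (\<lambda>i w. B (\<tau> (Suc i)) w - B (\<tau> i) w) {..<n})"

text \<open>The law of \<open>(x\<^sub>0 + \<sigma> B\<^sub>t)\<close>, \<open>t \<in> [0,T]\<close>, on path space.\<close>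

definition reference_law ::
  "real \<Rightarrow> real \<Rightarrow> real \<Rightarrow> 'w measure \<Rightarrow> (real \<Rightarrow> 'w \<Rightarrow> real) \<Rightarrow> (real \<Rightarrow> real) measure" where
  "reference_law T \<sigma> x0 W B = distr W (path_space T) (\<lambda>w. \<lambda>t\<in>{0..T}. x0 + \<sigma> * B t w)"

definition equivalent_laws :: "'a measure \<Rightarrow> 'a measure set" where
  "equivalent_laws P =
     {Q. prob_space Q \<and> sets Q = sets P \<and> absolutely_continuous P Q \<and> absolutely_continuous Q P}"

definition terminal_law :: "real \<Rightarrow> (real \<Rightarrow> real) measure \<Rightarrow> real measure" where
  "terminal_law T Q = distr Q borel (\<lambda>\<omega>. \<omega> T)"

text \<open>
  \<open>H(Q|P) = E\<^sup>Q[ln (dQ/dP)]\<close>. The library's \<^const>\<open>KL_divergence\<close> (whose reference measure comes first)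
  is a Bochner integral and hence \<open>0\<close> when the integrand is not integrable. As the negative
  part of \<open>ln (dQ/dP)\<close> always has finite \<open>Q\<close>-expectation, this is exactly the case \<open>H(Q|P) = \<infinity>\<close>.
\<close>

definition rel_entropy :: "'a measure \<Rightarrow> 'a measure \<Rightarrow> ereal" where
  "rel_entropy Q P =
     (if integrable Q (entropy_density (exp 1) P Q) then ereal (KL_divergence (exp 1) P Q) else \<infinity>)"

text \<open>
  Rewards are total functions, but only their values on \<open>[0,1]\<close> are ever used.
\<close>

definition rank_rewards :: "(real \<Rightarrow> real) set" where
  "rank_rewards = {R. mono_on {0..1} R \<and> bounded (R ` {0..1})}"

definition payoff ::
  "real \<Rightarrow> real \<Rightarrow> real \<Rightarrow> (real \<Rightarrow> real) measure \<Rightarrow> (real \<Rightarrow> real) \<Rightarrow> real measure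
    \<Rightarrow> (real \<Rightarrow> real) measure \<Rightarrow> ereal" where
  "payoff T \<sigma> c P R \<mu> Q =
     ereal (\<integral>\<omega>. R (cdf \<mu> (\<omega> T)) \<partial>Q) - ereal (2 * c * \<sigma>\<^sup>2) * rel_entropy Q P"

definition best_value ::
  "real \<Rightarrow> real \<Rightarrow> real \<Rightarrow> (real \<Rightarrow> real) measure \<Rightarrow> (real \<Rightarrow> real) \<Rightarrow> real measure \<Rightarrow> ereal" where
  "best_value T \<sigma> c P R \<mu> = (SUP Q\<in>equivalent_laws P. payoff T \<sigma> c P R \<mu> Q)"

definition is_equilibrium ::
  "real \<Rightarrow> real \<Rightarrow> real \<Rightarrow> (real \<Rightarrow> real) measure \<Rightarrow> (real \<Rightarrow> real) \<Rightarrow> real measure \<Rightarrow> bool" where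
  "is_equilibrium T \<sigma> c P R \<mu> \<longleftrightarrow>
     (\<exists>Q\<in>equivalent_laws P. \<mu> = terminal_law T Q \<and> payoff T \<sigma> c P R \<mu> Q = best_value T \<sigma> c P R \<mu>)"

definition equilibrium ::
  "real \<Rightarrow> real \<Rightarrow> real \<Rightarrow> (real \<Rightarrow> real) measure \<Rightarrow> (real \<Rightarrow> real) \<Rightarrow> real measure" where
  "equilibrium T \<sigma> c P R = (THE \<mu>. is_equilibrium T \<sigma> c P R \<mu>)"

definition game_value ::
  "real \<Rightarrow> real \<Rightarrow> real \<Rightarrow> (real \<Rightarrow> real) measure \<Rightarrow> (real \<Rightarrow> real) \<Rightarrow> ereal" where
  "game_value T \<sigma> c P R = best_value T \<sigma> c P R (equilibrium T \<sigma> c P R)"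

definition total_effort ::
  "real \<Rightarrow> real \<Rightarrow> real \<Rightarrow> real \<Rightarrow> (real \<Rightarrow> real) measure \<Rightarrow> (real \<Rightarrow> real) \<Rightarrow> real" where
  "total_effort T \<sigma> c x0 P R = (\<integral>y. y \<partial>equilibrium T \<sigma> c P R) - x0"

definition feasible_rewards ::
  "real \<Rightarrow> real \<Rightarrow> real \<Rightarrow> (real \<Rightarrow> real) measure \<Rightarrow> real \<Rightarrow> real \<Rightarrow> (real \<Rightarrow> real) set" where
  "feasible_rewards T \<sigma> c P V0 K =
     {R \<in> rank_rewards. ereal V0 \<le> game_value T \<sigma> c P R \<and> (LBINT r:{0..1}. R r) \<le> K}"

definition optimal_reward ::
  "real \<Rightarrow> real \<Rightarrow> real \<Rightarrow> real \<Rightarrow> (real \<Rightarrow> real) measure \<Rightarrow> real \<Rightarrow> real \<Rightarrow> (real \<Rightarrow> real) \<Rightarrow> bool" where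
  "optimal_reward T \<sigma> c x0 P V0 K R \<longleftrightarrow>
     R \<in> feasible_rewards T \<sigma> c P V0 K \<and>
     (\<forall>R'\<in>feasible_rewards T \<sigma> c P V0 K. total_effort T \<sigma> c x0 P R' \<le> total_effort T \<sigma> c x0 P R)"

definition f0 :: "real \<Rightarrow> real \<Rightarrow> real \<Rightarrow> real \<Rightarrow> real" where
  "f0 T \<sigma> x0 = normal_density x0 (\<sigma> * sqrt T)"

definition tilted_density :: "real \<Rightarrow> real \<Rightarrow> real \<Rightarrow> real \<Rightarrow> real \<Rightarrow> real \<Rightarrow> real" where
  "tilted_density T \<sigma> x0 lam M y =
     f0 T \<sigma> x0 y * exp (max (min y M) (- M) / lam) /
     (LBINT z. f0 T \<sigma> x0 z * exp (max (min z M) (- M) / lam))"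

definition tilted_law :: "real \<Rightarrow> real \<Rightarrow> real \<Rightarrow> real \<Rightarrow> real \<Rightarrow> real measure" where
  "tilted_law T \<sigma> x0 lam M = density lborel (\<lambda>y. ennreal (tilted_density T \<sigma> x0 lam M y))"

definition quantile :: "real measure \<Rightarrow> real \<Rightarrow> real" where
  "quantile \<mu> r = Inf {y. r \<le> cdf \<mu> y}"

definition zeta :: "real \<Rightarrow> real \<Rightarrow> real \<Rightarrow> real \<Rightarrow> real \<Rightarrow> real \<Rightarrow> real" where
  "zeta T \<sigma> x0 lam M y = tilted_density T \<sigma> x0 lam M y / f0 T \<sigma> x0 y"

definition reward_interior ::
  "real \<Rightarrow> real \<Rightarrow> real \<Rightarrow> real \<Rightarrow> real \<Rightarrow> real \<Rightarrow> real \<Rightarrow> real \<Rightarrow> real" where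
  "reward_interior T \<sigma> c x0 V0 lam M r =
     2 * c * \<sigma>\<^sup>2 * ln (zeta T \<sigma> x0 lam M (quantile (tilted_law T \<sigma> x0 lam M) r)) + V0"

text \<open>
  The quantile is infinite at ranks \<open>0\<close> and \<open>1\<close>, so the reward takes its one-sided limits there.
\<close>

definition truncated_reward ::
  "real \<Rightarrow> real \<Rightarrow> real \<Rightarrow> real \<Rightarrow> real \<Rightarrow> real \<Rightarrow> real \<Rightarrow> real \<Rightarrow> real" where
  "truncated_reward T \<sigma> c x0 V0 lam M r =
     (if r \<le> 0 then Lim (at_right 0) (reward_interior T \<sigma> c x0 V0 lam M)
      else if r \<ge> 1 then Lim (at_left 1) (reward_interior T \<sigma> c x0 V0 lam M)
      else reward_interior T \<sigma> c x0 V0 lam M r)"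

end

theory Submission
  imports Defs "HOL-Real_Asymp.Real_Asymp"
begin

text \<open>
  Write \<open>k = 2 c \<sigma>\<^sup>2\<close> and let \<open>N\<close> be the Gaussian law of the endpoint under the reference law. By the
  Gibbs variational principle the best response to a law \<open>\<mu>\<close> of the population has density
  proportional to \<open>exp (R (F\<^sub>\<mu> (X\<^sub>T)) / k)\<close>. Since this is a function of the endpoint, \<open>\<mu>\<close> is an
  equilibrium exactly when it is the corresponding tilt of \<open>N\<close>, a fixed-point equation
  (\<open>is_equilibrium_iff_fixed_law\<close>). The equation can be solved: ranks are uniform under \<open>\<mu>\<close>, hence
  under \<open>N\<close> the \<open>\<mu>\<close>-rank has density proportional to \<open>exp (- R / k)\<close>, which determines \<open>F\<^sub>\<mu>\<close>
  (\<open>fixed_law_rank\<close>, \<open>fixed_law_unique\<close>, \<open>fixed_law_exists\<close>). The same computation gives the value of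
  the game, \<open>- k ln D\<close> with \<open>D = \<integral>\<^sub>0\<^sup>1 exp (- R / k)\<close>, and, as ranks are uniform,
  \<open>\<integral>\<^sub>0\<^sup>1 R = k H(\<mu>|N) - k ln D\<close>.

  A feasible reward therefore satisfies \<open>k H(\<mu>|N) \<le> K - V\<^sub>0\<close>, and the problem is to move the mean of a
  Gaussian as far as possible within an entropy budget. Testing the entropy against linear functions
  bounds the displacement by \<open>t \<sigma>\<^sup>2 T / 2 + (K - V\<^sub>0) / (k t)\<close> for every \<open>t > 0\<close> (\<open>effort_bound\<close>), and
  the best \<open>t\<close> gives the claimed bound (\<open>effort_le\<close>). If \<open>K = V\<^sub>0\<close>, feasibility is already the equality
  case of Jensen's inequality for \<open>exp\<close>, so \<open>R\<close> is constant (\<open>feasible_tight\<close>).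

  If \<open>K > V\<^sub>0\<close>, equality would need the tilt \<open>exp (y / \<lambda>)\<close>, which belongs to an unbounded reward. Its
  truncation at level \<open>M\<close> is the equilibrium of the truncated reward by construction. It stays
  within the budget because truncating an increasing log-density lowers the entropy
  (\<open>tilted_law_entropy\<close>), and its mean is within \<open>O(exp (- M / \<lambda>))\<close> of the optimum because the
  truncated and the full weight differ only for \<open>|y| > M\<close> (\<open>truncated_effort_error\<close>).
\<close>

section \<open>The Gibbs variational principle\<close>

definition gibbs_law :: "real \<Rightarrow> ('a \<Rightarrow> real) \<Rightarrow> 'a measure \<Rightarrow> 'a measure" where
  "gibbs_law k G P = density P (\<lambda>x. ennreal (exp (G x / k) / (\<integral>x. exp (G x / k) \<partial>P)))"

locale bounded_potential = prob_space P for P :: "'a measure" +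
  fixes G :: "'a \<Rightarrow> real" and k b :: real
  assumes meas[measurable]: "G \<in> borel_measurable P"
    and bound: "\<And>x. \<bar>G x\<bar> \<le> b"
    and k_pos: "0 < k"
begin

abbreviation Z :: real where "Z \<equiv> \<integral>x. exp (G x / k) \<partial>P"

lemma exp_bounds: "exp (- b / k) \<le> exp (G x / k)" "exp (G x / k) \<le> exp (b / k)"
  using bound[of x] k_pos by (auto simp: abs_le_iff pos_le_divide_eq pos_divide_le_eq)

lemma integrable_exp: "integrable P (\<lambda>x. exp (G x / k))"
  by (rule integrable_const_bound[where B="exp (b / k)"]) (use exp_bounds in auto)

lemma Z_pos: "0 < Z"
proof -
  have "(\<integral>x. exp (- b / k) \<partial>P) \<le> Z"
    by (intro integral_mono integrable_exp exp_bounds) auto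
  then show ?thesis
    using exp_gt_zero[of "- b / k"] by (simp add: prob_space del: exp_gt_zero)
qed

lemma gibbs_law_prob: "prob_space (gibbs_law k G P)"
proof -
  have "(\<integral>\<^sup>+x. ennreal (exp (G x / k) / Z) \<partial>P) = ennreal (\<integral>x. exp (G x / k) / Z \<partial>P)"
    using Z_pos by (intro nn_integral_eq_integral integrable_divide integrable_exp) auto
  also have "\<dots> = 1"
    using Z_pos by simp
  finally show ?thesis
    unfolding gibbs_law_def by (intro prob_spaceI) (simp add: emeasure_density)
qed

lemma gibbs_law_equivalent: "gibbs_law k G P \<in> equivalent_laws P"
proof -
  have "absolutely_continuous (gibbs_law k G P) P"
    unfolding absolutely_continuous_def gibbs_law_def
  proof
    fix A assume "A \<in> null_sets (density P (\<lambda>x. ennreal (exp (G x / k) / Z)))"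
    then have A: "A \<in> sets P" "AE x in P. x \<in> A \<longrightarrow> ennreal (exp (G x / k) / Z) = 0"
      by (simp_all add: null_sets_density_iff)
    have "AE x in P. x \<notin> A"
      using A(2) by (rule AE_mp) (use Z_pos in \<open>auto simp: ennreal_eq_0_iff divide_le_0_iff not_le\<close>)
    then show "A \<in> null_sets P"
      using A(1) by (simp add: AE_iff_null_sets)
  qed
  moreover have "absolutely_continuous P (gibbs_law k G P)"
    unfolding gibbs_law_def by (rule absolutely_continuousI_density) simp
  ultimately show ?thesis
    using gibbs_law_prob by (simp add: equivalent_laws_def) (simp add: gibbs_law_def)
qed

text \<open>
  Put \<open>L = G / k - ln (dQ/dP) - ln Z\<close>. Then \<open>exp L\<close> has \<open>Q\<close>-expectation \<open>1\<close>, so \<open>1 + L \<le> exp L\<close> gives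
  \<open>E\<^sup>Q[L] \<le> 0\<close>, which is the inequality. Equality makes the nonnegative difference
  \<open>exp L - 1 - L\<close> vanish almost everywhere, that is \<open>L = 0\<close>.
\<close>

lemma gibbs_inequality:
  assumes Q: "Q \<in> equivalent_laws P" and fin: "integrable Q (entropy_density (exp 1) P Q)"
  shows "(\<integral>x. G x \<partial>Q) - k * KL_divergence (exp 1) P Q \<le> k * ln Z"
    and "(\<integral>x. G x \<partial>Q) - k * KL_divergence (exp 1) P Q = k * ln Z \<Longrightarrow> Q = gibbs_law k G P"
proof -
  have sets: "sets Q = sets P" and ac: "absolutely_continuous P Q" "absolutely_continuous Q P"
    using Q by (auto simp: equivalent_laws_def)
  interpret Q: prob_space Q
    using Q by (simp add: equivalent_laws_def)
  have [measurable_cong]: "sets Q = sets P" by (rule sets)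
  obtain D where D: "D \<in> borel_measurable P" "AE x in P. RN_deriv P Q x = ennreal (D x)"
      "AE x in Q. 0 < D x" "\<And>x. 0 \<le> D x"
    using real_RN_deriv[OF Q.finite_measure_axioms ac(1) sets] by blast
  note [measurable] = D(1)
  have Q_eq: "Q = density P (\<lambda>x. ennreal (D x))"
    using density_RN_deriv[OF ac(1) sets] density_cong[OF _ _ D(2)] by simp
  have D_pos: "AE x in P. 0 < D x"
    using absolutely_continuous_AE[OF sets[symmetric] ac(2) D(3)] .
  have entr: "AE x in Q. entropy_density (exp 1) P Q x = ln (D x)"
    using absolutely_continuous_AE[OF sets ac(1) D(2)]
    by eventually_elim (use D(4) in \<open>simp add: entropy_density_def log_def\<close>)
  have ln_int: "integrable Q (\<lambda>x. ln (D x))"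
    using fin integrable_cong_AE[THEN iffD1, OF _ _ entr] measurable_entropy_density[of "exp 1" P Q]
    by simp
  have KL: "KL_divergence (exp 1) P Q = (\<integral>x. ln (D x) \<partial>Q)"
    unfolding KL_divergence_def
    by (intro integral_cong_AE entr) (use measurable_entropy_density[of "exp 1" P Q] in simp_all)
  have G_int: "integrable Q G"
    by (rule Q.integrable_const_bound[where B=b]) (use bound in auto)
  define L where "L x = G x / k - ln (D x) - ln Z" for x
  have [measurable]: "L \<in> borel_measurable P"
    unfolding L_def by measurable
  have L_int: "integrable Q L"
    unfolding L_def using G_int ln_int by simp
  have int_L: "(\<integral>x. L x \<partial>Q) = (\<integral>x. G x \<partial>Q) / k - KL_divergence (exp 1) P Q - ln Z"
    unfolding L_def KL using G_int ln_int by (simp add: Q.prob_space)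
  have expL: "AE x in P. D x * exp (L x) = exp (G x / k) / Z"
    using D_pos by eventually_elim (use Z_pos in \<open>simp add: L_def exp_diff\<close>)
  have "integrable P (\<lambda>x. D x * exp (L x)) \<longleftrightarrow> integrable P (\<lambda>x. exp (G x / k) / Z)"
    by (intro integrable_cong_AE expL) simp_all
  then have exp_int: "integrable Q (\<lambda>x. exp (L x))"
    unfolding Q_eq using D(4) integrable_exp by (subst integrable_density) auto
  have "(\<integral>x. exp (L x) \<partial>Q) = (\<integral>x. D x * exp (L x) \<partial>P)"
    unfolding Q_eq using D(4) by (subst integral_density) auto
  also have "\<dots> = (\<integral>x. exp (G x / k) / Z \<partial>P)"
    by (intro integral_cong_AE expL) simp_all
  also have "\<dots> = 1"
    using Z_pos by simp
  finally have exp_1: "(\<integral>x. exp (L x) \<partial>Q) = 1" .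
  define E where "E x = exp (L x) - 1 - L x" for x
  have E_nonneg: "0 \<le> E x" for x
    unfolding E_def using exp_ge_add_one_self[of "L x"] by linarith
  have E_int: "integrable Q E"
    unfolding E_def using exp_int L_int by simp
  have int_E: "(\<integral>x. E x \<partial>Q) = - (\<integral>x. L x \<partial>Q)"
    unfolding E_def using exp_int L_int by (simp add: exp_1 Q.prob_space)
  have gap: "k * (\<integral>x. E x \<partial>Q) = k * ln Z - ((\<integral>x. G x \<partial>Q) - k * KL_divergence (exp 1) P Q)"
    unfolding int_E int_L using k_pos by (simp add: field_simps)
  have "0 \<le> k * (\<integral>x. E x \<partial>Q)"
    using k_pos E_nonneg by simp
  then show "(\<integral>x. G x \<partial>Q) - k * KL_divergence (exp 1) P Q \<le> k * ln Z"
    using gap by simp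
  assume "(\<integral>x. G x \<partial>Q) - k * KL_divergence (exp 1) P Q = k * ln Z"
  then have "(\<integral>x. E x \<partial>Q) = 0"
    using gap k_pos by simp
  then have "AE x in Q. E x = 0"
    using integral_nonneg_eq_0_iff_AE[OF E_int] E_nonneg by simp
  then have "AE x in P. E x = 0"
    by (rule absolutely_continuous_AE[OF sets[symmetric] ac(2)])
  then have "AE x in P. ennreal (D x) = ennreal (exp (G x / k) / Z)"
    using expL
  proof eventually_elim
    case (elim x)
    from elim(1) have "L x = 0"
      using ln_eq_minus_one[of "exp (L x)"] by (simp add: E_def)
    then show ?case using elim(2) by simp
  qed
  then show "Q = gibbs_law k G P"
    unfolding Q_eq gibbs_law_def by (intro density_cong) simp_all
qed

text \<open>
  The log-density of the tilt is affine in the bounded function \<open>G\<close>: its entropy is finite, and its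
  expectation reproduces \<open>G\<close> up to the constant \<open>k ln Z\<close>.
\<close>

lemma gibbs_law_attains:
  "integrable (gibbs_law k G P) (entropy_density (exp 1) P (gibbs_law k G P))"
  "(\<integral>x. G x \<partial>gibbs_law k G P) - k * KL_divergence (exp 1) P (gibbs_law k G P) = k * ln Z"
proof -
  let ?Q = "gibbs_law k G P"
  interpret Q: prob_space ?Q by (rule gibbs_law_prob)
  have sets: "sets ?Q = sets P" by (simp add: gibbs_law_def)
  have [measurable_cong]: "sets ?Q = sets P" by (rule sets)
  have ac: "absolutely_continuous P ?Q"
    using gibbs_law_equivalent by (simp add: equivalent_laws_def)
  have RN: "AE x in P. ennreal (exp (G x / k) / Z) = RN_deriv P ?Q x"
    by (rule RN_deriv_unique) (simp_all add: gibbs_law_def)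
  have entr: "AE x in ?Q. entropy_density (exp 1) P ?Q x = G x / k - ln Z"
    using absolutely_continuous_AE[OF sets ac RN]
  proof eventually_elim
    case (elim x)
    show ?case
      unfolding entropy_density_def comp_def elim[symmetric] using Z_pos by (simp add: log_def ln_div)
  qed
  have G_int: "integrable ?Q G"
    by (rule Q.integrable_const_bound[where B=b]) (use bound in auto)
  have [measurable]: "entropy_density (exp 1) P ?Q \<in> borel_measurable P" by simp
  show "integrable ?Q (entropy_density (exp 1) P ?Q)"
    using integrable_cong_AE[THEN iffD2, OF _ _ entr] G_int by simp
  have "KL_divergence (exp 1) P ?Q = (\<integral>x. G x / k - ln Z \<partial>?Q)"
    unfolding KL_divergence_def by (intro integral_cong_AE entr) simp_all
  also have "\<dots> = (\<integral>x. G x \<partial>?Q) / k - ln Z"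
    using G_int by (simp add: Q.prob_space)
  finally show "(\<integral>x. G x \<partial>?Q) - k * KL_divergence (exp 1) P ?Q = k * ln Z"
    using k_pos by (simp add: field_simps)
qed

lemma gibbs_variational:
  defines "J Q \<equiv> ereal (\<integral>x. G x \<partial>Q) - ereal k * rel_entropy Q P"
  shows "(SUP Q\<in>equivalent_laws P. J Q) = ereal (k * ln Z)"
    and "Q \<in> equivalent_laws P \<Longrightarrow> J Q = ereal (k * ln Z) \<longleftrightarrow> Q = gibbs_law k G P"
proof -
  have le: "J Q \<le> ereal (k * ln Z)" and eq: "J Q = ereal (k * ln Z) \<Longrightarrow> Q = gibbs_law k G P"
    if "Q \<in> equivalent_laws P" for Q
    using gibbs_inequality[OF that] k_pos
    by (cases "integrable Q (entropy_density (exp 1) P Q)"; simp add: J_def rel_entropy_def)+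
  have att: "J (gibbs_law k G P) = ereal (k * ln Z)"
    using gibbs_law_attains by (simp add: J_def rel_entropy_def)
  show "(SUP Q\<in>equivalent_laws P. J Q) = ereal (k * ln Z)"
    using le SUP_upper[OF gibbs_law_equivalent, of J] by (intro antisym SUP_least) (simp_all add: att)
  show "J Q = ereal (k * ln Z) \<longleftrightarrow> Q = gibbs_law k G P" if "Q \<in> equivalent_laws P"
    using eq[OF that] att by auto
qed

end


section \<open>Laws with a continuous strictly increasing distribution function\<close>

abbreviation unit_law :: "real measure" where
  "unit_law \<equiv> uniform_measure lborel {0..1}"

lemma unit_law_density: "unit_law = density lborel (\<lambda>r. ennreal (indicator {0..1} r))"
  unfolding uniform_measure_def by (intro density_cong) (simp_all add: indicator_def)

lemma prob_space_unit_law: "prob_space unit_law"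
  by (rule prob_space_uniform_measure) simp_all

lemma real_distribution_unit_law: "real_distribution unit_law"
  by (simp add: real_distribution_def real_distribution_axioms_def prob_space_unit_law)

lemma integral_unit_law:
  fixes h :: "real \<Rightarrow> real"
  assumes [measurable]: "h \<in> borel_measurable borel"
  shows "(\<integral>r. h r \<partial>unit_law) = (LBINT r:{0..1}. h r)"
  unfolding unit_law_density set_lebesgue_integral_def
  by (subst integral_density[where g="indicator {0..1}"]) auto

lemma AE_unit_law:
  assumes [measurable]: "Measurable.pred borel P"
  shows "(AE r in unit_law. P r) \<longleftrightarrow> (AE r in lborel. r \<in> {0..1} \<longrightarrow> P r)"
  by (subst AE_uniform_measure) simp_all

lemma cdf_unit_law: "0 \<le> r \<Longrightarrow> r \<le> 1 \<Longrightarrow> cdf unit_law r = r"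
proof -
  assume r: "0 \<le> r" "r \<le> 1"
  have "{0..1} \<inter> {..r} = {0..r}" using r by auto
  then show ?thesis using r by (simp add: cdf_def)
qed

lemma cdf_distr:
  "f \<in> borel_measurable M \<Longrightarrow> cdf (distr M borel f) r = measure M {x \<in> space M. f x \<le> r}"
  by (simp add: cdf_def2 measure_distr vimage_def Int_def conj_commute)

text \<open>
  The rank of a sample from such a law is uniform, and every law equivalent to a Gaussian is of this
  kind, so all candidate equilibria are.
\<close>

locale regular_law = real_distribution M for M +
  assumes cdf_strict: "strict_mono (cdf M)" and cdf_isCont: "isCont (cdf M) x"
begin

lemma cdf_le_iff: "cdf M x \<le> cdf M y \<longleftrightarrow> x \<le> y"
  using cdf_strict by (rule strict_mono_less_eq)

lemma cdf_pos: "0 < cdf M x"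
  using strict_monoD[OF cdf_strict, of "x - 1" x] cdf_nonneg[of "x - 1"] by simp

lemma cdf_less_1: "cdf M x < 1"
  using strict_monoD[OF cdf_strict, of x "x + 1"] cdf_bounded_prob[of "x + 1"] by simp

lemma cdf_measurable[measurable]: "cdf M \<in> borel_measurable borel"
  by (intro borel_measurable_mono monoI cdf_nondecreasing)

lemma cdf_attains:
  assumes "0 < r" "r < 1" obtains x where "cdf M x = r"
proof -
  obtain l where l: "cdf M l < r"
    using order_tendstoD(2)[OF cdf_lim_at_bot assms(1)] eventually_happens[of _ at_bot] by force
  obtain u where u: "r < cdf M u"
    using order_tendstoD(1)[OF cdf_lim_at_top_prob assms(2)] eventually_happens[of _ at_top] by force
  have "l \<le> u" using l u cdf_le_iff[of u l] by linarith
  then show ?thesis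
    using IVT[of "cdf M" l r u] l u cdf_isCont that by (meson less_imp_le)
qed

lemma measure_cdf_le:
  assumes "0 \<le> r" "r \<le> 1" shows "measure M {x. cdf M x \<le> r} = r"
proof (cases "r = 0 \<or> r = 1")
  case True
  then show ?thesis
    using cdf_pos cdf_less_1 prob_space by (auto simp: not_le[symmetric] less_imp_le)
next
  case False
  then obtain x where x: "cdf M x = r" using assms cdf_attains[of r] by force
  then have "{y. cdf M y \<le> r} = {..x}" using cdf_le_iff by auto
  then show ?thesis using x by (simp add: cdf_def)
qed

text \<open>
  The probability integral transform: it turns expectations of functions of the rank under an
  equilibrium into integrals over \<open>[0,1]\<close> that no longer mention the equilibrium.
\<close>

lemma distr_cdf: "distr M borel (cdf M) = unit_law"
proof (rule cdf_unique)
  show "real_distribution (distr M borel (cdf M))" by simp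
  show "real_distribution unit_law" by (rule real_distribution_unit_law)
  show "cdf (distr M borel (cdf M)) = cdf unit_law"
  proof
    fix r :: real
    have eq: "cdf (distr M borel (cdf M)) r = measure M {x. cdf M x \<le> r}"
      by (simp add: cdf_distr)
    consider "r < 0" | "0 \<le> r" "r \<le> 1" | "1 < r" by linarith
    then show "cdf (distr M borel (cdf M)) r = cdf unit_law r"
    proof cases
      case 1
      then have "{x. cdf M x \<le> r} = {}" "{0..1} \<inter> {..r} = {}"
        using cdf_pos by (auto simp: not_le intro: less_trans)
      then show ?thesis unfolding eq by (simp add: cdf_def)
    next
      case 2
      then show ?thesis unfolding eq by (simp add: measure_cdf_le cdf_unit_law)
    next
      case 3
      then have "{x. cdf M x \<le> r} = UNIV" "{0..1} \<inter> {..r} = {0..1}"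
        using cdf_less_1 by (auto intro: less_imp_le less_trans)
      then show ?thesis unfolding eq using prob_space by (simp add: cdf_def)
    qed
  qed
qed

lemma integral_cdf:
  fixes h :: "real \<Rightarrow> real"
  assumes "h \<in> borel_measurable borel"
  shows "(\<integral>x. h (cdf M x) \<partial>M) = (\<integral>r. h r \<partial>unit_law)"
  using integral_distr[of "cdf M" M borel h] assms by (simp add: distr_cdf)

text \<open>
  Strict monotonicity says that intervals are not null sets and continuity that points are; equivalent
  laws share their null sets.
\<close>

lemma regular_law_equivalent:
  assumes "Q \<in> equivalent_laws M" shows "regular_law Q"
proof -
  have sets: "sets Q = sets borel" and ac: "absolutely_continuous M Q" "absolutely_continuous Q M"
    using assms by (auto simp: equivalent_laws_def)
  interpret Q: prob_space Q using assms by (simp add: equivalent_laws_def)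
  interpret Q: real_distribution Q by standard (rule sets)
  have null: "measure Q A = 0 \<longleftrightarrow> measure M A = 0" if "A \<in> sets borel" for A
  proof -
    have "A \<in> null_sets Q \<longleftrightarrow> A \<in> null_sets M"
      using ac by (auto simp: absolutely_continuous_def)
    then show ?thesis
      using that sets by (simp add: null_sets_def Q.emeasure_eq_measure emeasure_eq_measure)
  qed
  show ?thesis
  proof
    show "strict_mono (cdf Q)"
    proof (rule strict_monoI)
      fix x y :: real assume "x < y"
      then have "measure M {x<..y} \<noteq> 0"
        using cdf_diff_eq[of x y] strict_monoD[OF cdf_strict, of x y] by simp
      then have "0 < measure Q {x<..y}" using null by (simp add: zero_less_measure_iff)
      then show "cdf Q x < cdf Q y"
        using Q.cdf_diff_eq[OF \<open>x < y\<close>] by linarith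
    qed
    show "isCont (cdf Q) x" for x
      using cdf_isCont[of x] null[of "{x}"] by (simp add: isCont_cdf Q.isCont_cdf)
  qed
qed

end

section \<open>Fixed points of the rank feedback\<close>

text \<open>
  A reward that is monotone on the whole line composes measurably with any distribution function. For
  the contest it is the constant continuation of a reward on \<open>[0,1]\<close>.
\<close>

locale rank_reward = regular_law N for N +
  fixes R :: "real \<Rightarrow> real" and k b :: real
  assumes R_mono: "mono R" and R_bound: "\<And>r. \<bar>R r\<bar> \<le> b" and k_pos: "0 < k"
begin

lemma R_measurable[measurable]: "R \<in> borel_measurable borel"
  by (rule borel_measurable_mono[OF R_mono])

text \<open>
  On the space of ranks the relevant potential is \<open>- R\<close>: a fixed law has density proportional to
  \<open>exp (R / k)\<close> in its rank, so going back to \<open>N\<close> costs the reciprocal.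
\<close>

sublocale rank: bounded_potential unit_law "\<lambda>r. - R r" k b
proof -
  interpret U: prob_space unit_law by (rule prob_space_unit_law)
  show "bounded_potential unit_law (\<lambda>r. - R r) k b"
    by standard (use R_bound k_pos in auto)
qed

abbreviation D :: real where "D \<equiv> \<integral>r. exp (- R r / k) \<partial>unit_law"

abbreviation rank_law :: "real measure" where "rank_law \<equiv> gibbs_law k (\<lambda>r. - R r) unit_law"

lemma rank_law_real: "real_distribution rank_law"
  using rank.gibbs_law_prob by (auto simp: real_distribution_def real_distribution_axioms_def gibbs_law_def)

lemma rank_law_null:
  assumes "A \<in> sets borel" shows "measure rank_law A = 0 \<longleftrightarrow> measure unit_law A = 0"
proof -
  interpret Q: prob_space rank_law by (rule rank.gibbs_law_prob)
  have "A \<in> null_sets rank_law \<longleftrightarrow> A \<in> null_sets unit_law"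
    using rank.gibbs_law_equivalent by (auto simp: absolutely_continuous_def equivalent_laws_def)
  then show ?thesis
    using assms by (simp add: null_sets_def Q.emeasure_eq_measure rank.emeasure_eq_measure)
      (simp add: gibbs_law_def)
qed

lemma cdf_rank_law_strict:
  assumes "u < v" "0 < v" "u < 1" shows "cdf rank_law u < cdf rank_law v"
proof -
  interpret Q: real_distribution rank_law by (rule rank_law_real)
  have "{0..1} \<inter> {max 0 u<..min v 1} = {max 0 u<..min v 1}" by auto
  then have "measure unit_law {max 0 u<..min v 1} \<noteq> 0"
    using assms by (simp add: measure_uniform_measure)
  then have "measure rank_law {max 0 u<..min v 1} \<noteq> 0" using rank_law_null by simp
  then have "0 < measure rank_law {max 0 u<..min v 1}"
    using measure_nonneg[of rank_law "{max 0 u<..min v 1}"] by linarith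
  also have "\<dots> \<le> measure rank_law {u<..v}"
    by (rule Q.finite_measure_mono) (auto simp: gibbs_law_def)
  finally show ?thesis using Q.cdf_diff_eq[OF assms(1)] by linarith
qed

lemma cdf_rank_law_inj:
  assumes "u \<in> {0<..<1}" "v \<in> {0<..<1}" "cdf rank_law u = cdf rank_law v" shows "u = v"
  using cdf_rank_law_strict[of u v] cdf_rank_law_strict[of v u] assms
  by (cases u v rule: linorder_cases) auto

lemma rank_law_attains:
  assumes "0 < p" "p < 1" obtains u where "0 < u" "u < 1" "cdf rank_law u = p"
proof -
  interpret Q: real_distribution rank_law by (rule rank_law_real)
  have "{0..1} \<inter> {..0} = {0::real}" by auto
  then have 0: "cdf rank_law 0 = 0"
    unfolding cdf_def by (subst rank_law_null) simp_all
  have "{0..1} \<inter> {1<..} = ({}::real set)" by auto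
  then have "measure rank_law {1<..} = 0"
    by (subst rank_law_null) simp_all
  then have 1: "cdf rank_law 1 = 1"
    unfolding cdf_def using Q.prob_compl[of "{1<..}"] by (simp add: Compl_eq_Diff_UNIV[symmetric])
  have "isCont (cdf rank_law) x" for x
    unfolding Q.isCont_cdf by (subst rank_law_null) (simp_all add: measure_uniform_measure Int_insert_right)
  then obtain u where u: "0 \<le> u" "u \<le> 1" "cdf rank_law u = p"
    using IVT[of "cdf rank_law" 0 p 1] 0 1 assms by auto
  then have "u \<noteq> 0" "u \<noteq> 1" using 0 1 assms by auto
  then show ?thesis using u that[of u] by auto
qed

lemma R_integrable: "integrable unit_law R"
proof (rule rank.integrable_const_bound[where B=b])
  show "R \<in> borel_measurable unit_law" by measurable
qed (use R_bound in simp)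

text \<open>
  The law is the Gibbs tilt of \<open>N\<close> for the rewards which it itself assigns: the equilibrium condition
  projected to the endpoint.
\<close>

definition fixed_law :: "real measure \<Rightarrow> bool" where
  "fixed_law \<mu> \<longleftrightarrow> real_distribution \<mu> \<and> \<mu> = gibbs_law k (\<lambda>x. R (cdf \<mu> x)) N"

lemma fixed_lawI:
  assumes "real_distribution \<mu>" "gibbs_law k (\<lambda>x. R (cdf \<mu> x)) N = \<mu>"
  shows "fixed_law \<mu>"
  unfolding fixed_law_def using assms(1) assms(2)[symmetric] by (rule conjI)

lemma potential:
  assumes "real_distribution \<mu>" shows "bounded_potential N (\<lambda>x. R (cdf \<mu> x)) k b"
proof -
  interpret \<mu>: real_distribution \<mu> by fact
  have [measurable]: "cdf \<mu> \<in> borel_measurable borel"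
    by (intro borel_measurable_mono monoI \<mu>.cdf_nondecreasing)
  show ?thesis by standard (use R_bound k_pos in auto)
qed

lemma fixed_law_gibbs: "fixed_law \<mu> \<Longrightarrow> gibbs_law k (\<lambda>x. R (cdf \<mu> x)) N = \<mu>"
  unfolding fixed_law_def by (rule sym) (rule conjunct2)

lemma fixed_law_regular:
  assumes \<mu>: "fixed_law \<mu>" shows "regular_law \<mu>"
proof -
  have "bounded_potential N (\<lambda>x. R (cdf \<mu> x)) k b"
    using \<mu> by (intro potential) (simp only: fixed_law_def)
  from regular_law_equivalent[OF bounded_potential.gibbs_law_equivalent[OF this]]
  show ?thesis unfolding fixed_law_gibbs[OF \<mu>] .
qed

text \<open>
  Under \<open>\<mu>\<close> the \<open>\<mu>\<close>-rank is uniform, and \<open>d\<mu>/dN\<close> is the function \<open>exp (R / k) / Z\<close> of that rank. Hence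
  under \<open>N\<close> the rank has density \<open>Z exp (- R / k)\<close> on \<open>[0,1]\<close>, and total mass one forces \<open>Z D = 1\<close>.
\<close>

lemma fixed_law_rank:
  assumes \<mu>: "fixed_law \<mu>"
  shows "distr N borel (cdf \<mu>) = rank_law"
    and "(\<integral>x. exp (R (cdf \<mu> x) / k) \<partial>N) = 1 / D"
proof -
  interpret \<mu>: regular_law \<mu> by (rule fixed_law_regular[OF \<mu>])
  interpret G: bounded_potential N "\<lambda>x. R (cdf \<mu> x)" k b by (rule potential[OF \<mu>.real_distribution_axioms])
  have pos: "0 < G.Z" "0 < D" by (rule G.Z_pos rank.Z_pos)+
  have "unit_law = distr (density N (\<lambda>x. ennreal (exp (R (cdf \<mu> x) / k) / G.Z))) borel (cdf \<mu>)"
    using \<mu>.distr_cdf fixed_law_gibbs[OF \<mu>, symmetric] by (simp only: gibbs_law_def)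
  also have "\<dots> = density (distr N borel (cdf \<mu>)) (\<lambda>r. ennreal (exp (R r / k) / G.Z))"
    by (subst density_distr) simp_all
  finally have U: "unit_law = density (distr N borel (cdf \<mu>)) (\<lambda>r. ennreal (exp (R r / k) / G.Z))" .
  have one: "ennreal (exp (R r / k) / G.Z) * ennreal (exp (- R r / k) * G.Z) = 1" for r
    using pos by (subst ennreal_mult[symmetric]) (simp_all add: exp_minus field_simps)
  have "density unit_law (\<lambda>r. ennreal (exp (- R r / k) * G.Z)) =
      density (distr N borel (cdf \<mu>)) (\<lambda>r. ennreal (exp (R r / k) / G.Z) * ennreal (exp (- R r / k) * G.Z))"
    by (subst U, rule density_density_eq) simp_all
  also have "\<dots> = density (distr N borel (cdf \<mu>)) (\<lambda>_. 1)"
    by (simp only: one)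
  finally have eq: "density unit_law (\<lambda>r. ennreal (exp (- R r / k) * G.Z)) = distr N borel (cdf \<mu>)"
    by (simp add: density_1)
  interpret dN: prob_space "distr N borel (cdf \<mu>)" by (rule prob_space_distr) simp
  have "1 = emeasure (distr N borel (cdf \<mu>)) UNIV"
    using dN.emeasure_space_1 by simp
  also have "\<dots> = (\<integral>\<^sup>+r. ennreal (exp (- R r / k) * G.Z) \<partial>unit_law)"
    by (subst eq[symmetric], subst emeasure_density) simp_all
  also have "\<dots> = ennreal (\<integral>r. exp (- R r / k) * G.Z \<partial>unit_law)"
    using pos rank.integrable_exp by (intro nn_integral_eq_integral) auto
  also have "\<dots> = ennreal (D * G.Z)" by simp
  finally have "D * G.Z = 1" using pos by (simp add: ennreal_eq_1)
  then show Z: "G.Z = 1 / D" using pos by (simp add: field_simps)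
  show "distr N borel (cdf \<mu>) = rank_law"
    unfolding eq[symmetric] gibbs_law_def Z by simp
qed

text \<open>
  An explicit equation for the distribution function of a fixed law in terms of \<open>R\<close> and \<open>N\<close>; as the rank
  law charges every interval in \<open>[0,1]\<close>, it determines that function.
\<close>

lemma cdf_fixed_law:
  assumes "fixed_law \<mu>" shows "cdf rank_law (cdf \<mu> t) = cdf N t"
proof -
  interpret \<mu>: regular_law \<mu> by (rule fixed_law_regular[OF assms])
  show ?thesis
    unfolding fixed_law_rank(1)[OF assms, symmetric]
    by (subst cdf_distr) (simp_all add: \<mu>.cdf_le_iff, simp only: cdf_def2 atMost_def)
qed

lemma fixed_law_unique:
  assumes "fixed_law \<mu>" "fixed_law \<nu>" shows "\<mu> = \<nu>"
proof -
  interpret \<mu>: regular_law \<mu> by (rule fixed_law_regular[OF assms(1)])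
  interpret \<nu>: regular_law \<nu> by (rule fixed_law_regular[OF assms(2)])
  have "cdf \<mu> t = cdf \<nu> t" for t
    by (rule cdf_rank_law_inj)
       (simp_all add: cdf_fixed_law[OF assms(1)] cdf_fixed_law[OF assms(2)]
          \<mu>.cdf_pos \<mu>.cdf_less_1 \<nu>.cdf_pos \<nu>.cdf_less_1)
  then show ?thesis
    using \<mu>.real_distribution_axioms \<nu>.real_distribution_axioms by (intro cdf_unique ext)
qed

text \<open>
  Solve \<open>cdf rank_law (H t) = cdf N t\<close> for \<open>H\<close>. Then \<open>H\<close> has law \<open>rank_law\<close> under \<open>N\<close>, and weighting \<open>N\<close> by
  the reciprocal rank density makes \<open>H\<close> uniform. As \<open>H\<close> is strictly increasing, it is then the
  distribution function of the weighted law, which is therefore fixed.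
\<close>

lemma fixed_law_exists: "\<exists>\<mu>. fixed_law \<mu>"
proof -
  interpret \<gamma>: real_distribution rank_law by (rule rank_law_real)
  have "\<exists>u. 0 < u \<and> u < 1 \<and> cdf rank_law u = cdf N t" for t
    using rank_law_attains[OF cdf_pos cdf_less_1] by blast
  then obtain H where H: "\<And>t. 0 < H t" "\<And>t. H t < 1" "\<And>t. cdf rank_law (H t) = cdf N t"
    by metis
  have H_le: "H t \<le> u \<longleftrightarrow> cdf N t \<le> cdf rank_law u" for t u
    using cdf_rank_law_strict[of u "H t"] \<gamma>.cdf_nondecreasing[of "H t" u] H[of t] by force
  have H_mono: "H s \<le> H t \<longleftrightarrow> s \<le> t" for s t
    using H_le H(3) cdf_le_iff by simp
  have [measurable]: "H \<in> borel_measurable borel"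
    by (intro borel_measurable_mono monoI) (simp add: H_mono)
  have distr_H: "distr N borel H = rank_law"
  proof (rule cdf_unique[OF _ rank_law_real], simp, rule ext)
    fix u
    have "cdf (distr N borel H) u = measure N {t. cdf N t \<le> cdf rank_law u}"
      by (subst cdf_distr) (simp_all add: H_le)
    also have "\<dots> = cdf rank_law u"
      by (rule measure_cdf_le) (rule \<gamma>.cdf_nonneg \<gamma>.cdf_bounded_prob)+
    finally show "cdf (distr N borel H) u = cdf rank_law u" .
  qed
  have D_pos: "0 < D" by (rule rank.Z_pos)
  have "(\<integral>x. exp (R (H x) / k) \<partial>N) = (\<integral>r. exp (R r / k) \<partial>rank_law)"
    unfolding distr_H[symmetric] by (subst integral_distr) simp_all
  also have "\<dots> = (\<integral>r. exp (- R r / k) / D * exp (R r / k) \<partial>unit_law)"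
    unfolding gibbs_law_def using D_pos by (subst integral_density) auto
  also have "\<dots> = (\<integral>r. 1 / D \<partial>unit_law)"
    by (intro Bochner_Integration.integral_cong) (simp_all add: exp_minus)
  also have "\<dots> = 1 / D" by (simp add: rank.prob_space[simplified])
  finally have Z: "(\<integral>x. exp (R (H x) / k) \<partial>N) = 1 / D" .
  define \<mu> where "\<mu> = gibbs_law k (\<lambda>x. R (H x)) N"
  interpret \<mu>: bounded_potential N "\<lambda>x. R (H x)" k b
    by standard (use R_bound k_pos in auto)
  have \<mu>_real: "real_distribution \<mu>"
    using \<mu>.gibbs_law_prob by (auto simp: real_distribution_def real_distribution_axioms_def gibbs_law_def \<mu>_def)
  have one: "ennreal (exp (- R r / k) / D) * ennreal (exp (R r / k) * D) = 1" for r
    using D_pos by (subst ennreal_mult[symmetric]) (simp_all add: exp_minus field_simps)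
  have "distr \<mu> borel H = density (distr N borel H) (\<lambda>r. ennreal (exp (R r / k) * D))"
    unfolding \<mu>_def gibbs_law_def Z by (subst density_distr) simp_all
  also have "\<dots> = density unit_law (\<lambda>r. ennreal (exp (- R r / k) / D) * ennreal (exp (R r / k) * D))"
    unfolding distr_H gibbs_law_def by (rule density_density_eq) simp_all
  also have "\<dots> = density unit_law (\<lambda>_. 1)"
    by (simp only: one)
  finally have U: "distr \<mu> borel H = unit_law" by (simp add: density_1)
  have [measurable_cong]: "sets \<mu> = sets borel" by (simp add: \<mu>_def gibbs_law_def)
  have sp: "space \<mu> = UNIV" by (simp add: \<mu>_def gibbs_law_def)
  have cdf_H: "cdf \<mu> = H"
  proof
    fix t
    have "cdf \<mu> t = cdf (distr \<mu> borel H) (H t)"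
      by (subst cdf_distr) (simp_all add: H_mono sp, simp only: cdf_def2 atMost_def)
    then show "cdf \<mu> t = H t"
      unfolding U using H[of t] by (simp add: cdf_unit_law)
  qed
  have "fixed_law \<mu>"
    unfolding fixed_law_def cdf_H using \<mu>_real by (simp add: \<mu>_def)
  then show ?thesis ..
qed

end


section \<open>Equilibria of the contest\<close>

text \<open>
  Payoffs depend on the path through its endpoint and the entropy, so a reference law on paths enters
  through the Gaussian law of the endpoint.
\<close>

locale contest =
  prob_space P for P :: "(real \<Rightarrow> real) measure" +
  fixes T \<sigma> c x0 :: real
  assumes T_pos: "0 < T" and \<sigma>_pos: "0 < \<sigma>" and c_pos: "0 < c"
    and terminal_measurable[measurable]: "(\<lambda>\<omega>. \<omega> T) \<in> borel_measurable P"
    and terminal_reference: "terminal_law T P = density lborel (\<lambda>x. ennreal (f0 T \<sigma> x0 x))"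

lemma contest_reference_law:
  assumes "0 < T" "0 < \<sigma>" "0 < c" and B: "std_brownian_motion W T B"
  shows "contest (reference_law T \<sigma> x0 W B) T \<sigma> c x0"
proof -
  interpret W: prob_space W using B by (simp add: std_brownian_motion_def)
  have B_meas: "B t \<in> borel_measurable W" if "t \<in> {0..T}" for t
    using B that by (simp add: std_brownian_motion_def)
  have meas: "(\<lambda>w. \<lambda>t\<in>{0..T}. x0 + \<sigma> * B t w) \<in> measurable W (path_space T)"
    unfolding path_space_def
  proof (rule measurable_restrict_space2)
    show "(\<lambda>w. \<lambda>t\<in>{0..T}. x0 + \<sigma> * B t w) \<in> measurable W (\<Pi>\<^sub>M t\<in>{0..T}. borel)"
      by (rule measurable_restrict) (use B_meas in measurable)
    have "continuous_on {0..T} (\<lambda>t\<in>{0..T}. x0 + \<sigma> * B t w)" if "w \<in> space W" for w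
    proof (subst continuous_on_cong[OF refl])
      show "continuous_on {0..T} (\<lambda>t. x0 + \<sigma> * B t w)"
        using B that by (intro continuous_intros) (simp add: std_brownian_motion_def)
    qed simp
    then show "(\<lambda>w. \<lambda>t\<in>{0..T}. x0 + \<sigma> * B t w) \<in> space W \<rightarrow> {\<omega>. continuous_on {0..T} \<omega>}"
      by auto
  qed
  have T_meas: "(\<lambda>\<omega>. \<omega> T) \<in> borel_measurable (path_space T)"
    unfolding path_space_def using \<open>0 < T\<close>
    by (intro measurable_restrict_space1 measurable_component_singleton) simp
  have "distributed W lborel (\<lambda>w. B T w - B 0 w) (\<lambda>y. ennreal (normal_density 0 (sqrt (T - 0)) y))"
    using B \<open>0 < T\<close> unfolding std_brownian_motion_def by (meson atLeastAtMost_iff less_imp_le order_refl)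
  then have "distributed W lborel (\<lambda>w. x0 + \<sigma> * (B T w - B 0 w))
      (normal_density (x0 + \<sigma> * 0) (\<bar>\<sigma>\<bar> * sqrt (T - 0)))"
    using \<open>0 < T\<close> \<open>0 < \<sigma>\<close> by (intro W.normal_density_affine) simp_all
  then have "distr W lborel (\<lambda>w. x0 + \<sigma> * (B T w - B 0 w)) = density lborel (\<lambda>x. ennreal (f0 T \<sigma> x0 x))"
    using \<open>0 < \<sigma>\<close> by (auto dest!: distributed_distr_eq_density simp: f0_def)
  moreover have "distr W lborel (\<lambda>w. x0 + \<sigma> * (B T w - B 0 w)) = distr W borel (\<lambda>w. x0 + \<sigma> * B T w)"
    using B by (intro distr_cong) (auto simp: std_brownian_motion_def)
  moreover have "terminal_law T (reference_law T \<sigma> x0 W B) = distr W borel (\<lambda>w. x0 + \<sigma> * B T w)"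
    unfolding terminal_law_def reference_law_def using \<open>0 < T\<close>
    by (subst distr_distr[OF T_meas meas]) (auto intro!: distr_cong)
  ultimately have "terminal_law T (reference_law T \<sigma> x0 W B) = density lborel (\<lambda>x. ennreal (f0 T \<sigma> x0 x))"
    by simp
  moreover have "prob_space (reference_law T \<sigma> x0 W B)"
    unfolding reference_law_def by (rule W.prob_space_distr[OF meas])
  ultimately show ?thesis
    using assms T_meas by (simp add: contest_def contest_axioms_def reference_law_def)
qed

lemma regular_law_density:
  assumes [measurable]: "f \<in> borel_measurable borel" and pos: "\<And>x. 0 < f x"
    and "prob_space (density lborel (\<lambda>x. ennreal (f x)))"
  shows "regular_law (density lborel (\<lambda>x. ennreal (f x)))"
proof -
  let ?N = "density lborel (\<lambda>x. ennreal (f x))"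
  interpret prob_space ?N by fact
  interpret real_distribution ?N by standard simp
  have null: "measure ?N A = 0 \<longleftrightarrow> A \<in> null_sets lborel" if [measurable]: "A \<in> sets borel" for A
  proof -
    have "measure ?N A = 0 \<longleftrightarrow> A \<in> null_sets ?N"
      using that by (auto simp: null_sets_def emeasure_eq_measure)
    also have "\<dots> \<longleftrightarrow> (AE x in lborel. x \<notin> A)"
      using pos by (subst null_sets_density_iff) (simp_all add: ennreal_eq_0_iff flip: not_less)
    finally show ?thesis by (simp add: AE_iff_null_sets)
  qed
  show ?thesis
  proof
    show "strict_mono (cdf ?N)"
    proof (rule strict_monoI)
      fix x y :: real assume "x < y"
      then have "measure ?N {x<..y} \<noteq> 0" by (subst null) (simp_all add: null_sets_def)
      then have "0 < measure ?N {x<..y}" by (simp add: zero_less_measure_iff)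
      then show "cdf ?N x < cdf ?N y" using cdf_diff_eq[OF \<open>x < y\<close>] by linarith
    qed
    show "isCont (cdf ?N) x" for x
      unfolding isCont_cdf by (subst null) (simp_all add: null_sets_def)
  qed
qed

context contest
begin

abbreviation s :: real where "s \<equiv> \<sigma> * sqrt T"

abbreviation N :: "real measure" where
  "N \<equiv> density lborel (\<lambda>x. ennreal (f0 T \<sigma> x0 x))"

abbreviation k :: real where "k \<equiv> 2 * c * \<sigma>\<^sup>2"

lemma s_pos: "0 < s" and k_pos: "0 < k"
  using T_pos \<sigma>_pos c_pos by simp_all

lemma nonzero[simp]: "T \<noteq> 0" "\<sigma> \<noteq> 0" "c \<noteq> 0"
  using T_pos \<sigma>_pos c_pos by simp_all

lemma f0_pos: "0 < f0 T \<sigma> x0 x"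
  unfolding f0_def by (rule normal_density_pos[OF s_pos])

lemma f0_measurable[measurable]: "f0 T \<sigma> x0 \<in> borel_measurable borel"
  unfolding f0_def by simp

sublocale N: regular_law N
  using f0_pos prob_space_normal_density[OF s_pos, of x0]
  by (intro regular_law_density) (simp_all add: f0_def)

text \<open>
  The constant continuation from \<open>[0,1]\<close>, which keeps a monotone bounded reward monotone and bounded on
  the line. Ranks lie in \<open>[0,1]\<close>, so payoffs do not change.
\<close>

definition extend_reward :: "(real \<Rightarrow> real) \<Rightarrow> real \<Rightarrow> real" where
  "extend_reward R r = R (max 0 (min 1 r))"

lemma extend_reward_eq: "r \<in> {0..1} \<Longrightarrow> extend_reward R r = R r"
  by (simp add: extend_reward_def)

lemma rank_reward_extend:
  assumes "R \<in> rank_rewards" obtains b where "rank_reward N (extend_reward R) k b"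
proof -
  have R: "mono_on {0..1} R" "bounded (R ` {0..1})"
    using assms by (auto simp: rank_rewards_def)
  obtain b where b: "\<And>r. r \<in> {0..1} \<Longrightarrow> \<bar>R r\<bar> \<le> b"
    using R(2) by (metis bounded_iff imageI real_norm_def)
  have "rank_reward N (extend_reward R) k b"
  proof
    show "mono (extend_reward R)"
      unfolding extend_reward_def by (intro monoI mono_onD[OF R(1)]) auto
    show "\<bar>extend_reward R r\<bar> \<le> b" for r
      unfolding extend_reward_def by (rule b) auto
    show "0 < k" by (rule k_pos)
  qed
  then show ?thesis using that by blast
qed

text \<open>
  A density that is a function of the endpoint passes to the law of the endpoint, with the same
  normalising constant.
\<close>

lemma terminal_law_gibbs:
  assumes [measurable]: "g \<in> borel_measurable borel"
  shows "terminal_law T (gibbs_law a (\<lambda>\<omega>. g (\<omega> T)) P) = gibbs_law a g N"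
proof -
  have "(\<integral>\<omega>. exp (g (\<omega> T) / a) \<partial>P) = (\<integral>x. exp (g x / a) \<partial>N)"
    unfolding terminal_reference[symmetric] terminal_law_def by (subst integral_distr) simp_all
  then show ?thesis
    unfolding gibbs_law_def terminal_law_def terminal_reference[symmetric]
    by (subst density_distr) simp_all
qed

lemma terminal_law_real:
  assumes "Q \<in> equivalent_laws P" shows "real_distribution (terminal_law T Q)"
proof -
  interpret Q: prob_space Q using assms by (simp add: equivalent_laws_def)
  have [measurable_cong]: "sets Q = sets P" using assms by (simp add: equivalent_laws_def)
  show ?thesis unfolding terminal_law_def by (intro Q.real_distribution_distr) measurable
qed

text \<open>
  The Gibbs variational principle on path space, for the potential that rewards the rank of the
  endpoint in the population \<open>\<mu>\<close>.
\<close>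

lemma best_response:
  assumes R: "R \<in> rank_rewards" and \<mu>: "real_distribution \<mu>"
  defines "G \<equiv> \<lambda>x. extend_reward R (cdf \<mu> x)"
  shows "best_value T \<sigma> c P R \<mu> = ereal (k * ln (\<integral>x. exp (G x / k) \<partial>N))"
    and "Q \<in> equivalent_laws P \<Longrightarrow>
      payoff T \<sigma> c P R \<mu> Q = best_value T \<sigma> c P R \<mu> \<longleftrightarrow> Q = gibbs_law k (\<lambda>\<omega>. G (\<omega> T)) P"
    and "gibbs_law k (\<lambda>\<omega>. G (\<omega> T)) P \<in> equivalent_laws P"
    and "terminal_law T (gibbs_law k (\<lambda>\<omega>. G (\<omega> T)) P) = gibbs_law k G N"
proof -
  obtain b where "rank_reward N (extend_reward R) k b" using R by (rule rank_reward_extend)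
  then interpret rank_reward N "extend_reward R" k b .
  interpret \<mu>: real_distribution \<mu> by fact
  have [measurable]: "cdf \<mu> \<in> borel_measurable borel"
    by (intro borel_measurable_mono monoI \<mu>.cdf_nondecreasing)
  have G_meas[measurable]: "G \<in> borel_measurable borel" unfolding G_def by measurable
  interpret B: bounded_potential P "\<lambda>\<omega>. G (\<omega> T)" k b
    by standard (use R_bound k_pos in \<open>auto simp: G_def\<close>)
  have pay: "payoff T \<sigma> c P R \<mu> Q = ereal (\<integral>\<omega>. G (\<omega> T) \<partial>Q) - ereal k * rel_entropy Q P" for Q
    unfolding payoff_def G_def
    by (simp add: extend_reward_eq \<mu>.cdf_nonneg \<mu>.cdf_bounded_prob)
  have "(\<integral>\<omega>. exp (G (\<omega> T) / k) \<partial>P) = (\<integral>x. exp (G x / k) \<partial>N)"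
    unfolding terminal_reference[symmetric] terminal_law_def by (subst integral_distr) simp_all
  then show best: "best_value T \<sigma> c P R \<mu> = ereal (k * ln (\<integral>x. exp (G x / k) \<partial>N))"
    unfolding best_value_def pay B.gibbs_variational(1) by simp
  show "payoff T \<sigma> c P R \<mu> Q = best_value T \<sigma> c P R \<mu> \<longleftrightarrow> Q = gibbs_law k (\<lambda>\<omega>. G (\<omega> T)) P"
    if "Q \<in> equivalent_laws P"
    unfolding best_value_def pay B.gibbs_variational(1) using that by (rule B.gibbs_variational(2))
  show "gibbs_law k (\<lambda>\<omega>. G (\<omega> T)) P \<in> equivalent_laws P" by (rule B.gibbs_law_equivalent)
  show "terminal_law T (gibbs_law k (\<lambda>\<omega>. G (\<omega> T)) P) = gibbs_law k G N"
    by (rule terminal_law_gibbs[OF G_meas])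
qed

text \<open>
  The best response is unique, so an equilibrium is precisely a law that coincides with the endpoint law
  of the best response to it.
\<close>

lemma is_equilibrium_iff_fixed_law:
  assumes R: "R \<in> rank_rewards"
  shows "is_equilibrium T \<sigma> c P R \<mu> \<longleftrightarrow> rank_reward.fixed_law N (extend_reward R) k \<mu>"
proof -
  obtain b where "rank_reward N (extend_reward R) k b" using R by (rule rank_reward_extend)
  then interpret rank_reward N "extend_reward R" k b .
  show ?thesis
  proof
    assume "is_equilibrium T \<sigma> c P R \<mu>"
    then obtain Q where Q: "Q \<in> equivalent_laws P" "\<mu> = terminal_law T Q"
        "payoff T \<sigma> c P R \<mu> Q = best_value T \<sigma> c P R \<mu>"
      unfolding is_equilibrium_def by blast
    have \<mu>: "real_distribution \<mu>" unfolding Q(2) by (rule terminal_law_real[OF Q(1)])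
    show "fixed_law \<mu>"
      unfolding fixed_law_def
      using \<mu> Q(2) Q(3) best_response(2)[OF R \<mu> Q(1)] best_response(4)[OF R \<mu>] by metis
  next
    assume fp: "fixed_law \<mu>"
    then have \<mu>: "real_distribution \<mu>" by (simp only: fixed_law_def)
    show "is_equilibrium T \<sigma> c P R \<mu>"
      unfolding is_equilibrium_def
      using best_response(2)[OF R \<mu>] best_response(3,4)[OF R \<mu>] fixed_law_gibbs[OF fp] by metis
  qed
qed

lemma equilibrium_eqI:
  assumes R: "R \<in> rank_rewards" and fp: "rank_reward.fixed_law N (extend_reward R) k \<mu>"
  shows "equilibrium T \<sigma> c P R = \<mu>"
proof -
  obtain b where "rank_reward N (extend_reward R) k b" using R by (rule rank_reward_extend)
  then interpret rank_reward N "extend_reward R" k b .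
  show ?thesis
    unfolding equilibrium_def is_equilibrium_iff_fixed_law[OF R]
    using fp fixed_law_unique by blast
qed

lemma equilibrium_fixed_law:
  assumes R: "R \<in> rank_rewards"
  shows "rank_reward.fixed_law N (extend_reward R) k (equilibrium T \<sigma> c P R)"
proof -
  obtain b where "rank_reward N (extend_reward R) k b" using R by (rule rank_reward_extend)
  then interpret rank_reward N "extend_reward R" k b .
  show ?thesis using fixed_law_exists equilibrium_eqI[OF R] by metis
qed

text \<open>
  The value is \<open>k\<close> times the logarithm of the normalising constant of the best response, and at a fixed
  law this constant is \<open>1 / D\<close>: the value is an explicit functional of \<open>R\<close>.
\<close>

lemma game_value_eq:
  assumes R: "R \<in> rank_rewards"
  shows "game_value T \<sigma> c P R = ereal (- k * ln (\<integral>r. exp (- extend_reward R r / k) \<partial>unit_law))"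
proof -
  obtain b where "rank_reward N (extend_reward R) k b" using R by (rule rank_reward_extend)
  then interpret rank_reward N "extend_reward R" k b .
  note fp = equilibrium_fixed_law[OF R]
  have \<mu>: "real_distribution (equilibrium T \<sigma> c P R)" using fp by (simp only: fixed_law_def)
  show ?thesis
    unfolding game_value_def best_response(1)[OF R \<mu>] fixed_law_rank(2)[OF fp]
    using rank.Z_pos by (simp add: ln_div)
qed

lemma integral_extend_reward:
  assumes R: "R \<in> rank_rewards"
  shows "(\<integral>r. extend_reward R r \<partial>unit_law) = (LBINT r:{0..1}. R r)"
proof -
  obtain b where "rank_reward N (extend_reward R) k b" using R by (rule rank_reward_extend)
  then interpret rank_reward N "extend_reward R" k b .
  show ?thesis
    unfolding integral_unit_law[OF R_measurable]
    by (intro set_lebesgue_integral_cong) (simp_all add: extend_reward_eq)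
qed

end


section \<open>The optimal displacement for a given entropy\<close>

lemma normal_density_tilt:
  assumes "0 < s"
  shows "normal_density m s y * exp (t * (y - m) - t\<^sup>2 * s\<^sup>2 / 2) = normal_density (m + t * s\<^sup>2) s y"
proof -
  have "- (y - m)\<^sup>2 / (2 * s\<^sup>2) + (t * (y - m) - t\<^sup>2 * s\<^sup>2 / 2) = - (y - (m + t * s\<^sup>2))\<^sup>2 / (2 * s\<^sup>2)"
    using assms by (simp add: field_simps power2_eq_square)
  then show ?thesis
    unfolding normal_density_def by (simp add: mult.assoc flip: exp_add)
qed

context contest
begin

text \<open>
  The density of the Gaussian with mean \<open>x0 + t s\<^sup>2\<close> and variance \<open>s\<^sup>2\<close> with respect to \<open>N\<close>.
\<close>

abbreviation tilt :: "real \<Rightarrow> real \<Rightarrow> real" where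
  "tilt t y \<equiv> exp (t * (y - x0) - t\<^sup>2 * s\<^sup>2 / 2)"

lemma f0_tilt: "f0 T \<sigma> x0 y * tilt t y = normal_density (x0 + t * s\<^sup>2) s y"
  unfolding f0_def by (rule normal_density_tilt[OF s_pos])

lemma integral_N:
  fixes h :: "real \<Rightarrow> real"
  assumes [measurable]: "h \<in> borel_measurable borel"
  shows "(\<integral>y. h y \<partial>N) = (\<integral>y. f0 T \<sigma> x0 y * h y \<partial>lborel)"
    and "integrable N h \<longleftrightarrow> integrable lborel (\<lambda>y. f0 T \<sigma> x0 y * h y)"
  using f0_pos by (simp_all add: integral_density integrable_density less_imp_le)

lemma tilted_moments:
  shows "integrable N (tilt t)" "(\<integral>y. tilt t y \<partial>N) = 1"
    and "integrable N (\<lambda>y. tilt t y * y)" "(\<integral>y. tilt t y * y \<partial>N) = x0 + t * s\<^sup>2"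
  using integrable_normal_density[OF s_pos] integrable_normal_moment_nz_1[OF s_pos]
    integral_normal_moment_nz_1[OF s_pos]
  by (simp_all add: integral_N f0_tilt mult.assoc[symmetric] integral_normal_density[OF s_pos] del: power_mult_distrib)

lemma exponential_moments:
  shows "integrable N (\<lambda>y. exp (t * y))" "integrable N (\<lambda>y. exp (t * y) * y)"
proof -
  have eq: "exp (t * y) = exp (t * x0 + t\<^sup>2 * s\<^sup>2 / 2) * tilt t y" for y
    by (simp add: algebra_simps flip: exp_add)
  show "integrable N (\<lambda>y. exp (t * y))"
    unfolding eq by (intro integrable_mult_right tilted_moments)
  show "integrable N (\<lambda>y. exp (t * y) * y)"
    unfolding eq mult.assoc by (intro integrable_mult_right tilted_moments)
qed

lemma reference_moments:
  "integrable N (\<lambda>y. y)" "(\<integral>y. y \<partial>N) = x0"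
  using tilted_moments(3,4)[of 0] by simp_all

lemma bounded_density_moment:
  fixes \<zeta> :: "real \<Rightarrow> real"
  assumes [measurable]: "\<zeta> \<in> borel_measurable borel" and bd: "\<And>y. \<bar>\<zeta> y\<bar> \<le> B"
    and h: "integrable N h"
  shows "integrable N (\<lambda>y. \<zeta> y * h y)"
proof (rule Bochner_Integration.integrable_bound)
  show "integrable N (\<lambda>y. B * h y)" using h by simp
  have [measurable]: "h \<in> borel_measurable borel" using h by (simp add: integrable_iff_bounded)
  show "(\<lambda>y. \<zeta> y * h y) \<in> borel_measurable N" by simp
  have "0 \<le> B" using bd[of 0] by linarith
  then show "AE y in N. norm (\<zeta> y * h y) \<le> norm (B * h y)"
    using bd by (intro always_eventually allI) (auto simp: abs_mult intro!: mult_right_mono)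
qed

text \<open>
  Let \<open>exp l\<close> be the density of the equilibrium \<open>\<mu>\<close> with respect to \<open>N\<close> and \<open>exp a\<close> the tilt with
  parameter \<open>t\<close>. From \<open>a - l \<le> exp (a - l) - 1\<close> and the fact that both densities have mass one,
  \<open>E\<^sup>\<mu>[a] \<le> E\<^sup>\<mu>[l]\<close>. The left-hand side is \<open>t\<close> times the effort minus \<open>t\<^sup>2 s\<^sup>2 / 2\<close>; the right-hand side is
  the relative entropy of \<open>\<mu>\<close>, which is \<open>\<integral> R / k + ln D\<close> because ranks are uniform.
\<close>

lemma effort_bound:
  assumes R: "R \<in> rank_rewards" and t: "0 < t"
  shows "total_effort T \<sigma> c x0 P R \<le>
    t * s\<^sup>2 / 2 + ((LBINT r:{0..1}. R r) + k * ln (\<integral>r. exp (- extend_reward R r / k) \<partial>unit_law)) / (k * t)"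
proof -
  obtain b where "rank_reward N (extend_reward R) k b" using R by (rule rank_reward_extend)
  then interpret rank_reward N "extend_reward R" k b .
  define \<mu> where "\<mu> = equilibrium T \<sigma> c P R"
  have fp: "fixed_law \<mu>" unfolding \<mu>_def by (rule equilibrium_fixed_law[OF R])
  interpret \<mu>: regular_law \<mu> by (rule fixed_law_regular[OF fp])
  interpret G: bounded_potential N "\<lambda>x. extend_reward R (cdf \<mu> x)" k b
    by (rule potential[OF \<mu>.real_distribution_axioms])
  have D_pos: "0 < D" by (rule rank.Z_pos)
  define l where "l y = extend_reward R (cdf \<mu> y) / k + ln D" for y
  have l_meas[measurable]: "l \<in> borel_measurable borel" unfolding l_def by measurable
  have \<mu>_eq: "\<mu> = density N (\<lambda>y. ennreal (exp (l y)))"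
    unfolding l_def exp_add using fixed_law_gibbs[OF fp, symmetric] D_pos
    unfolding gibbs_law_def fixed_law_rank(2)[OF fp] by simp
  have l_bd: "\<bar>l y\<bar> \<le> b / k + \<bar>ln D\<bar>" for y
  proof -
    have "\<bar>extend_reward R (cdf \<mu> y) / k\<bar> \<le> b / k"
      using R_bound[of "cdf \<mu> y"] k_pos by (simp add: divide_right_mono)
    then show ?thesis unfolding l_def by linarith
  qed
  have exp_bd: "\<bar>exp (l y)\<bar> \<le> exp (b / k + \<bar>ln D\<bar>)" for y
    using l_bd[of y] by simp
  have int: "integrable N (\<lambda>y. exp (l y) * h y)" if "integrable N h" for h :: "real \<Rightarrow> real"
    by (rule bounded_density_moment[OF _ exp_bd that]) simp
  have \<mu>_int: "(\<integral>y. h y \<partial>\<mu>) = (\<integral>y. exp (l y) * h y \<partial>N)"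
    if "h \<in> borel_measurable borel" for h :: "real \<Rightarrow> real"
    using that unfolding \<mu>_eq by (subst integral_density) auto
  have l_int: "integrable N l"
    by (rule N.integrable_const_bound[where B="b / k + \<bar>ln D\<bar>"]) (use l_bd in auto)
  have one: "(\<integral>y. exp (l y) \<partial>N) = 1" "integrable N (\<lambda>y. exp (l y))"
    using \<mu>_int[of "\<lambda>_. 1"] \<mu>.prob_space int[of "\<lambda>_. 1"] by simp_all
  have ent: "(\<integral>y. exp (l y) * l y \<partial>N) = (LBINT r:{0..1}. R r) / k + ln D"
  proof -
    have "(\<integral>y. exp (l y) * l y \<partial>N) = (\<integral>y. extend_reward R (cdf \<mu> y) / k + ln D \<partial>\<mu>)"
      unfolding l_def[symmetric] by (rule \<mu>_int[symmetric]) simp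
    also have "\<dots> = (\<integral>r. extend_reward R r / k + ln D \<partial>unit_law)"
      by (rule \<mu>.integral_cdf) simp
    also have "\<dots> = (\<integral>r. extend_reward R r \<partial>unit_law) / k + ln D"
      using R_integrable by simp
    finally show ?thesis unfolding integral_extend_reward[OF R] .
  qed
  define a where "a y = t * (y - x0) - t\<^sup>2 * s\<^sup>2 / 2" for y
  have a_int: "integrable N a" unfolding a_def using reference_moments by simp
  have pt: "exp (l y) * a y - exp (l y) * l y \<le> tilt t y - exp (l y)" for y
  proof -
    have "a y - l y \<le> exp (a y - l y) - 1" using exp_ge_add_one_self[of "a y - l y"] by linarith
    then have "exp (l y) * (a y - l y) \<le> exp (l y) * (exp (a y - l y) - 1)" by (rule mult_left_mono) simp
    also have "\<dots> = tilt t y - exp (l y)" by (simp add: right_diff_distrib a_def flip: exp_add)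
    finally show ?thesis by (simp add: right_diff_distrib)
  qed
  have "(\<integral>y. exp (l y) * a y - exp (l y) * l y \<partial>N) \<le> (\<integral>y. tilt t y - exp (l y) \<partial>N)"
    by (rule integral_mono) (use int[OF a_int] int[OF l_int] one tilted_moments(1)[of t] pt in auto)
  also have "\<dots> = 0"
    using one tilted_moments(1,2)[of t] by (subst Bochner_Integration.integral_diff) auto
  finally have main: "(\<integral>y. exp (l y) * a y \<partial>N) \<le> (\<integral>y. exp (l y) * l y \<partial>N)"
    using int[OF a_int] int[OF l_int] by simp
  have "(\<integral>y. exp (l y) * a y \<partial>N) = (\<integral>y. t * (exp (l y) * y) - (t * x0 + t\<^sup>2 * s\<^sup>2 / 2) * exp (l y) \<partial>N)"
    unfolding a_def by (simp add: algebra_simps)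
  also have "\<dots> = t * (\<integral>y. y \<partial>\<mu>) - (t * x0 + t\<^sup>2 * s\<^sup>2 / 2)"
    using int[OF reference_moments(1)] one by (simp add: \<mu>_int)
  finally have "t * total_effort T \<sigma> c x0 P R \<le> t\<^sup>2 * s\<^sup>2 / 2 + ((LBINT r:{0..1}. R r) / k + ln D)"
    using main ent unfolding total_effort_def \<mu>_def[symmetric] by (simp add: right_diff_distrib)
  then have "total_effort T \<sigma> c x0 P R \<le> (t\<^sup>2 * s\<^sup>2 / 2 + ((LBINT r:{0..1}. R r) / k + ln D)) / t"
    using t by (simp add: pos_le_divide_eq mult.commute)
  also have "\<dots> = t * s\<^sup>2 / 2 + ((LBINT r:{0..1}. R r) + k * ln D) / (k * t)"
    using t k_pos by (simp add: add_divide_distrib power2_eq_square) 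
  finally show ?thesis .
qed

lemma s_squared: "s\<^sup>2 = \<sigma>\<^sup>2 * T"
  using T_pos by (simp add: power_mult_distrib)

text \<open>
  By \<open>game_value_eq\<close>, feasibility is a bound on \<open>k\<close> times the relative entropy of the equilibrium.
\<close>

lemma feasible_gap:
  assumes "R \<in> feasible_rewards T \<sigma> c P V0 K"
  shows "(LBINT r:{0..1}. R r) + k * ln (\<integral>r. exp (- extend_reward R r / k) \<partial>unit_law) \<le> K - V0"
  using assms by (auto simp: feasible_rewards_def game_value_eq)

text \<open>
  The bound of \<open>effort_bound\<close> optimised over \<open>t\<close>.
\<close>

lemma effort_le:
  assumes R: "R \<in> feasible_rewards T \<sigma> c P V0 K" and le: "V0 \<le> K"
  shows "total_effort T \<sigma> c x0 P R \<le> sqrt ((K - V0) * T / c)"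
proof -
  have R': "R \<in> rank_rewards" using R by (simp add: feasible_rewards_def)
  have bd: "total_effort T \<sigma> c x0 P R \<le> t * s\<^sup>2 / 2 + (K - V0) / (k * t)" if "0 < t" for t
  proof -
    have "((LBINT r:{0..1}. R r) + k * ln (\<integral>r. exp (- extend_reward R r / k) \<partial>unit_law)) / (k * t) \<le>
        (K - V0) / (k * t)"
      by (rule divide_right_mono[OF feasible_gap[OF R]]) (use that k_pos in simp)
    then show ?thesis using effort_bound[OF R' that] by linarith
  qed
  show ?thesis
  proof (cases "K = V0")
    case True
    show ?thesis
    proof (rule ccontr)
      assume "\<not> ?thesis"
      then have A: "0 < total_effort T \<sigma> c x0 P R" using True by simp
      \<comment> \<open>without an entropy budget, this slope bounds the effort by half of itself\<close>
      have "0 < total_effort T \<sigma> c x0 P R / s\<^sup>2"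
        using A s_pos by (intro divide_pos_pos zero_less_power)
      from bd[OF this] show False using A True \<sigma>_pos T_pos by simp
    qed
  next
    case False
    define q where "q = sqrt ((K - V0) * T / c)"
    have q: "0 < q" "q\<^sup>2 = (K - V0) * T / c"
      using False le T_pos c_pos by (simp_all add: q_def)
    then have K: "K - V0 = q\<^sup>2 * c / T" using T_pos c_pos by (simp add: field_simps)
    \<comment> \<open>at this slope, the minimiser of the bound, its two summands are equal\<close>
    have "q / (\<sigma>\<^sup>2 * T) * s\<^sup>2 / 2 + (K - V0) / (k * (q / (\<sigma>\<^sup>2 * T))) = q"
      unfolding s_squared K using q(1) T_pos c_pos \<sigma>_pos by (simp add: field_simps power2_eq_square)
    then show ?thesis
      using bd[of "q / (\<sigma>\<^sup>2 * T)"] q(1) T_pos \<sigma>_pos unfolding q_def by simp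
  qed
qed

text \<open>
  Jensen's inequality gives \<open>- k ln D \<le> m\<close> for the mean \<open>m\<close> of \<open>R\<close>, while feasibility says
  \<open>m \<le> V\<^sub>0 \<le> - k ln D\<close>. So equality holds throughout, and the nonnegative Jensen gap
  \<open>exp x - 1 - x\<close> at \<open>x = (m - R) / k\<close> integrates to zero.
\<close>

lemma feasible_tight:
  assumes R: "R \<in> feasible_rewards T \<sigma> c P V0 V0"
  shows "AE r in lborel. r \<in> {0..1} \<longrightarrow> R r = V0"
proof -
  have R': "R \<in> rank_rewards" using R by (simp add: feasible_rewards_def)
  obtain b where "rank_reward N (extend_reward R) k b" using R' by (rule rank_reward_extend)
  then interpret rank_reward N "extend_reward R" k b .
  define m where "m = (LBINT r:{0..1}. R r)"
  have m_le: "m \<le> V0" using R by (simp add: feasible_rewards_def m_def)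
  have V0_le: "V0 \<le> - k * ln D" using R by (auto simp: feasible_rewards_def game_value_eq[OF R'])
  have D_pos: "0 < D" by (rule rank.Z_pos)
  define E where "E r = exp ((m - extend_reward R r) / k) - 1 - (m - extend_reward R r) / k" for r
  have E_nonneg: "0 \<le> E r" for r
    unfolding E_def using exp_ge_add_one_self[of "(m - extend_reward R r) / k"] by linarith
  have split: "exp ((m - extend_reward R r) / k) = exp (m / k) * exp (- extend_reward R r / k)" for r
    by (simp add: diff_divide_distrib flip: exp_add)
  have E_int: "integrable unit_law E"
    unfolding E_def split using R_integrable rank.integrable_exp by simp
  have "(\<integral>r. E r \<partial>unit_law) = exp (m / k) * D - 1 - (m - (\<integral>r. extend_reward R r \<partial>unit_law)) / k"
    unfolding E_def split using R_integrable rank.integrable_exp by simp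
  also have "\<dots> = exp (m / k + ln D) - 1"
    using D_pos by (simp add: integral_extend_reward[OF R'] m_def exp_add)
  finally have int_E: "(\<integral>r. E r \<partial>unit_law) = exp (m / k + ln D) - 1" .
  have "m \<le> k * (- ln D)" using m_le V0_le by simp
  then have "m / k \<le> - ln D" using k_pos by (simp add: pos_divide_le_eq mult.commute)
  moreover have "0 \<le> (\<integral>r. E r \<partial>unit_law)" using E_nonneg by simp
  ultimately have mD: "m / k + ln D = 0" unfolding int_E by simp
  then have E0: "(\<integral>r. E r \<partial>unit_law) = 0" unfolding int_E by simp
  have "m / k = - ln D" using mD by linarith
  then have "m = - k * ln D" by (simp add: field_simps)
  then have m: "m = V0" using m_le V0_le by linarith
  have "AE r in unit_law. E r = 0"
    using integral_nonneg_eq_0_iff_AE[OF E_int] E_nonneg E0 by simp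
  then have "AE r in unit_law. extend_reward R r = V0"
  proof eventually_elim
    case (elim r)
    then have "(m - extend_reward R r) / k = 0"
      using ln_eq_minus_one[of "exp ((m - extend_reward R r) / k)"] by (simp add: E_def)
    then show ?case using k_pos m by simp
  qed
  then have "AE r in lborel. r \<in> {0..1} \<longrightarrow> extend_reward R r = V0"
    by (subst (asm) AE_unit_law) simp_all
  then show ?thesis
    by eventually_elim (use extend_reward_eq in auto)
qed

lemma constant_reward:
  shows "(\<lambda>_. V0) \<in> feasible_rewards T \<sigma> c P V0 V0" "total_effort T \<sigma> c x0 P (\<lambda>_. V0) = 0"
proof -
  have R: "(\<lambda>_. V0) \<in> rank_rewards" by (simp add: rank_rewards_def mono_on_def image_constant_conv)
  have ext: "extend_reward (\<lambda>_. V0) = (\<lambda>_. V0)" by (simp add: extend_reward_def fun_eq_iff)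
  obtain b where "rank_reward N (extend_reward (\<lambda>_. V0)) k b" using R by (rule rank_reward_extend)
  then interpret rank_reward N "extend_reward (\<lambda>_. V0)" k b .
  have "gibbs_law k (\<lambda>_. V0) N = density N (\<lambda>_. 1)"
    unfolding gibbs_law_def using N.prob_space by simp
  then have "fixed_law N"
    unfolding fixed_law_def unfolding ext using N.real_distribution_axioms by (simp add: density_1)
  then have eq: "equilibrium T \<sigma> c P (\<lambda>_. V0) = N" by (rule equilibrium_eqI[OF R])
  show "total_effort T \<sigma> c x0 P (\<lambda>_. V0) = 0"
    unfolding total_effort_def eq by (simp add: reference_moments)
  have "game_value T \<sigma> c P (\<lambda>_. V0) = ereal V0"
    unfolding game_value_eq[OF R] ext using k_pos by simp
  moreover have const: "V0 = (LBINT r:{0..1::real}. V0)"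
    using integral_unit_law[of "\<lambda>_. V0"] rank.prob_space by simp
  ultimately show "(\<lambda>_. V0) \<in> feasible_rewards T \<sigma> c P V0 V0"
    using R by (simp add: feasible_rewards_def flip: const)
qed

end


section \<open>Truncated rewards\<close>

lemma exp_affine_div: "k \<noteq> 0 \<Longrightarrow> exp ((k * x + d) / k) = exp x * exp (d / k)" for k x d :: real
  by (simp add: add_divide_distrib exp_add)

lemma gibbs_law_affine: "k \<noteq> 0 \<Longrightarrow> gibbs_law k (\<lambda>x. k * h x + d) P = gibbs_law 1 h P"
  by (simp add: gibbs_law_def exp_affine_div)

locale truncated_contest = contest +
  fixes lam M V0 :: real
  assumes lam_pos: "0 < lam" and M_pos: "0 < M"
begin

abbreviation \<phi> :: "real \<Rightarrow> real" where "\<phi> y \<equiv> max (min y M) (- M) / lam"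

abbreviation \<mu> :: "real measure" where "\<mu> \<equiv> tilted_law T \<sigma> x0 lam M"

abbreviation R :: "real \<Rightarrow> real" where "R \<equiv> truncated_reward T \<sigma> c x0 V0 lam M"

lemma \<phi>_measurable[measurable]: "\<phi> \<in> borel_measurable borel"
  by measurable

lemma \<phi>_bounds: "- M / lam \<le> \<phi> y" "\<phi> y \<le> M / lam"
  using lam_pos M_pos by (auto intro!: divide_right_mono simp del: minus_divide_left[symmetric])

sublocale \<phi>: bounded_potential N \<phi> 1 "M / lam"
proof
  show "\<bar>\<phi> y\<bar> \<le> M / lam" for y using \<phi>_bounds[of y] by (simp add: abs_le_iff)
qed simp_all

lemma Z_eq: "(LBINT z. f0 T \<sigma> x0 z * exp (\<phi> z)) = \<phi>.Z"
  by (subst integral_N) simp_all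

lemma tilted_law_gibbs: "\<mu> = gibbs_law 1 \<phi> N"
proof -
  have "gibbs_law 1 \<phi> N = density lborel (\<lambda>y. ennreal (f0 T \<sigma> x0 y) * ennreal (exp (\<phi> y / 1) / \<phi>.Z))"
    unfolding gibbs_law_def by (rule density_density_eq) simp_all
  also have "\<dots> = \<mu>"
    unfolding tilted_law_def tilted_density_def Z_eq
    using f0_pos \<phi>.Z_pos by (intro density_cong) (simp_all add: less_imp_le flip: ennreal_mult)
  finally show ?thesis by simp
qed

sublocale \<mu>: regular_law \<mu>
  unfolding tilted_law_gibbs by (rule N.regular_law_equivalent[OF \<phi>.gibbs_law_equivalent])

lemma zeta_eq: "zeta T \<sigma> x0 lam M y = exp (\<phi> y) / \<phi>.Z"
  unfolding zeta_def tilted_density_def Z_eq using f0_pos[of y] by simp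

lemma quantile_cdf: "quantile \<mu> (cdf \<mu> y) = y"
proof -
  have "{z. cdf \<mu> y \<le> cdf \<mu> z} = {y..}" by (auto simp: \<mu>.cdf_le_iff)
  then show ?thesis by (simp add: quantile_def)
qed

text \<open>
  Along the ranks of \<open>\<mu>\<close> the reward is \<open>k\<close> times the log-density of \<open>\<mu>\<close>, up to a constant. This is what
  makes \<open>\<mu>\<close> its own best response.
\<close>

lemma reward_interior_cdf:
  "reward_interior T \<sigma> c x0 V0 lam M (cdf \<mu> y) = k * \<phi> y + (V0 - k * ln \<phi>.Z)"
  unfolding reward_interior_def quantile_cdf zeta_eq
  using \<phi>.Z_pos by (simp add: ln_div right_diff_distrib)

lemma truncated_reward_cdf: "R (cdf \<mu> y) = k * \<phi> y + (V0 - k * ln \<phi>.Z)"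
  using \<mu>.cdf_pos[of y] \<mu>.cdf_less_1[of y]
  by (simp add: truncated_reward_def reward_interior_cdf)

text \<open>
  Ranks below \<open>cdf \<mu> (- M)\<close> belong to points at which the truncation is active, so the reward is constant
  near rank \<open>0\<close>, and likewise near rank \<open>1\<close>.
\<close>

lemma truncated_reward_0: "R 0 = k * (- M / lam) + (V0 - k * ln \<phi>.Z)"
proof -
  have "\<forall>\<^sub>F r in at_right 0. reward_interior T \<sigma> c x0 V0 lam M r = k * (- M / lam) + (V0 - k * ln \<phi>.Z)"
    unfolding eventually_at_right_field
  proof (intro exI[of _ "cdf \<mu> (- M)"] conjI allI impI)
    fix r assume r: "0 < r" "r < cdf \<mu> (- M)"
    then obtain y where y: "cdf \<mu> y = r" using \<mu>.cdf_attains[of r] \<mu>.cdf_less_1[of "- M"] by force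
    then have "y \<le> - M" using r \<mu>.cdf_le_iff[of y "- M"] by simp
    then have "\<phi> y = - M / lam" using M_pos by (simp add: max_def min_def)
    then show "reward_interior T \<sigma> c x0 V0 lam M r = k * (- M / lam) + (V0 - k * ln \<phi>.Z)"
      unfolding y[symmetric] reward_interior_cdf by simp
  qed (rule \<mu>.cdf_pos)
  then have "Lim (at_right 0) (reward_interior T \<sigma> c x0 V0 lam M) = k * (- M / lam) + (V0 - k * ln \<phi>.Z)"
    by (intro tendsto_Lim tendsto_eventually) simp_all
  then show ?thesis by (simp add: truncated_reward_def)
qed

lemma truncated_reward_1: "R 1 = k * (M / lam) + (V0 - k * ln \<phi>.Z)"
proof -
  have "\<forall>\<^sub>F r in at_left 1. reward_interior T \<sigma> c x0 V0 lam M r = k * (M / lam) + (V0 - k * ln \<phi>.Z)"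
    unfolding eventually_at_left_field
  proof (intro exI[of _ "cdf \<mu> M"] conjI allI impI)
    fix r assume r: "cdf \<mu> M < r" "r < 1"
    then obtain y where y: "cdf \<mu> y = r" using \<mu>.cdf_attains[of r] \<mu>.cdf_pos[of M] by force
    then have "M \<le> y" using r \<mu>.cdf_le_iff[of M y] by simp
    then have "\<phi> y = M / lam" using M_pos by (simp add: max_def min_def)
    then show "reward_interior T \<sigma> c x0 V0 lam M r = k * (M / lam) + (V0 - k * ln \<phi>.Z)"
      unfolding y[symmetric] reward_interior_cdf by simp
  qed (rule \<mu>.cdf_less_1)
  then have "Lim (at_left 1) (reward_interior T \<sigma> c x0 V0 lam M) = k * (M / lam) + (V0 - k * ln \<phi>.Z)"
    by (intro tendsto_Lim tendsto_eventually) simp_all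
  then show ?thesis by (simp add: truncated_reward_def)
qed

lemma truncated_reward_rank: "R \<in> rank_rewards"
proof -
  have bd: "R 0 \<le> R r \<and> R r \<le> R 1" if "0 \<le> r" "r \<le> 1" for r
  proof (cases "r = 0 \<or> r = 1")
    case True
    have "R 0 \<le> R 1"
      unfolding truncated_reward_0 truncated_reward_1 using M_pos lam_pos k_pos
      by (intro add_right_mono mult_left_mono divide_right_mono) simp_all
    then show ?thesis using True by auto
  next
    case False
    then have "0 < r" "r < 1" using that by auto
    then obtain y where y: "cdf \<mu> y = r" by (rule \<mu>.cdf_attains)
    show ?thesis
      unfolding y[symmetric] truncated_reward_cdf truncated_reward_0 truncated_reward_1
      using k_pos \<phi>_bounds[of y] by (intro conjI add_right_mono mult_left_mono) simp_all
  qed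
  have "R r \<le> R r'" if r: "0 \<le> r" "r \<le> r'" "r' \<le> 1" for r r'
  proof (cases "r = 0 \<or> r' = 1")
    case True
    then show ?thesis using bd[of r] bd[of r'] r by auto
  next
    case False
    then have "0 < r" "r < 1" "0 < r'" "r' < 1" using r by auto
    then obtain y y' where y: "cdf \<mu> y = r" "cdf \<mu> y' = r'"
      using \<mu>.cdf_attains by metis
    then have "y \<le> y'" using r \<mu>.cdf_le_iff by auto
    then have "\<phi> y \<le> \<phi> y'" using lam_pos by (intro divide_right_mono max.mono min.mono) simp_all
    then show ?thesis
      unfolding y[symmetric] truncated_reward_cdf using k_pos
      by (intro add_right_mono mult_left_mono) simp_all
  qed
  moreover have "R ` {0..1} \<subseteq> {R 0..R 1}" using bd by auto
  then have "bounded (R ` {0..1})" by (rule bounded_subset[OF bounded_closed_interval])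
  ultimately show ?thesis by (auto simp: rank_rewards_def mono_on_def)
qed

lemma extend_truncated_reward: "extend_reward R (cdf \<mu> y) = k * \<phi> y + (V0 - k * ln \<phi>.Z)"
  using \<mu>.cdf_pos[of y] \<mu>.cdf_less_1[of y] by (simp add: extend_reward_eq truncated_reward_cdf)

lemma tilted_law_fixed: "rank_reward.fixed_law N (extend_reward R) k \<mu>"
proof -
  obtain b where "rank_reward N (extend_reward R) k b" using truncated_reward_rank by (rule rank_reward_extend)
  then interpret rank_reward N "extend_reward R" k b .
  have "gibbs_law k (\<lambda>x. extend_reward R (cdf \<mu> x)) N = gibbs_law 1 \<phi> N"
    unfolding extend_truncated_reward by (rule gibbs_law_affine) simp
  also have "\<dots> = \<mu>" by (rule tilted_law_gibbs[symmetric])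
  finally show ?thesis
    by (rule fixed_lawI[OF \<mu>.real_distribution_axioms])
qed

lemma truncated_equilibrium: "equilibrium T \<sigma> c P R = \<mu>"
  by (rule equilibrium_eqI[OF truncated_reward_rank tilted_law_fixed])

lemma truncated_game_value: "game_value T \<sigma> c P R = ereal V0"
proof -
  obtain b where "rank_reward N (extend_reward R) k b" using truncated_reward_rank by (rule rank_reward_extend)
  then interpret rank_reward N "extend_reward R" k b .
  have k0: "k \<noteq> 0" by simp
  have "1 / D = \<phi>.Z * exp ((V0 - k * ln \<phi>.Z) / k)"
    unfolding fixed_law_rank(2)[OF tilted_law_fixed, symmetric] extend_truncated_reward
    by (simp only: exp_affine_div[OF k0] integral_mult_left_zero div_by_1)
  then have "ln (1 / D) = ln \<phi>.Z + (V0 - k * ln \<phi>.Z) / k"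
    using \<phi>.Z_pos by (simp only: ln_mult_pos exp_gt_zero ln_exp)
  moreover have "u * (z + (V0 - u * z) / u) = V0" if "u \<noteq> 0" for u z :: real
    using that by (simp add: field_simps)
  ultimately have "k * ln (1 / D) = V0" using k0 by (simp only:)
  then have "- k * ln D = V0" using rank.Z_pos by (simp add: ln_div)
  then show ?thesis unfolding game_value_eq[OF truncated_reward_rank] by simp
qed

lemma integral_tilted_law:
  fixes h :: "real \<Rightarrow> real"
  assumes [measurable]: "h \<in> borel_measurable borel"
  shows "(\<integral>y. h y \<partial>\<mu>) = (\<integral>y. exp (\<phi> y) * h y \<partial>N) / \<phi>.Z"
  unfolding tilted_law_gibbs gibbs_law_def using \<phi>.Z_pos
  by (subst integral_density) simp_all

lemma integrable_exp_\<phi>: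
  assumes "integrable N h" shows "integrable N (\<lambda>y. exp (\<phi> y) * h y)"
  using \<phi>.exp_bounds(2) by (intro bounded_density_moment[where B="exp (M / lam)", OF _ _ assms]) simp_all

text \<open>
  Truncation does not increase the entropy: the right-hand side is the relative entropy of the full tilt
  \<open>exp a\<close>, the left-hand side that of the truncated one \<open>exp l\<close>. Both \<open>l\<close> and \<open>a - l\<close> are increasing, so
  \<open>exp a\<close> has more mass than \<open>exp l\<close> where \<open>l\<close> is large, whence \<open>\<integral> l exp l \<le> \<integral> l exp a\<close>; and
  \<open>\<integral> l exp a \<le> \<integral> a exp a\<close> by Gibbs' inequality.
\<close>

lemma tilted_law_entropy: "(\<integral>y. \<phi> y - ln \<phi>.Z \<partial>\<mu>) \<le> (1 / lam)\<^sup>2 * s\<^sup>2 / 2"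
proof -
  let ?t = "1 / lam"
  define a where "a y = ?t * (y - x0) - ?t\<^sup>2 * s\<^sup>2 / 2" for y
  define l where "l y = \<phi> y - ln \<phi>.Z" for y
  have tilt_a: "tilt ?t y = exp (a y)" for y by (simp add: a_def)
  have [measurable]: "a \<in> borel_measurable borel" "l \<in> borel_measurable borel"
    unfolding a_def l_def by measurable
  have expl: "exp (l y) = exp (\<phi> y) / \<phi>.Z" for y
    unfolding l_def using \<phi>.Z_pos by (simp add: exp_diff)
  have one: "integrable N (\<lambda>y. exp (l y))" "(\<integral>y. exp (l y) \<partial>N) = 1"
      "integrable N (\<lambda>y. exp (a y))" "(\<integral>y. exp (a y) \<partial>N) = 1"
    using \<phi>.integrable_exp \<phi>.Z_pos tilted_moments(1,2)[of ?t, unfolded tilt_a] by (simp_all add: expl)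
  have \<phi>_abs: "\<bar>\<phi> y\<bar> \<le> M / lam" for y by (rule \<phi>.bound)
  have int_\<phi>: "integrable N (\<lambda>y. \<phi> y * exp (l y))" "integrable N (\<lambda>y. \<phi> y * exp (a y))"
    by (rule bounded_density_moment[OF \<phi>_measurable \<phi>_abs] one)+
  have int_a: "integrable N (\<lambda>y. exp (a y) * a y)" "(\<integral>y. exp (a y) * a y \<partial>N) = ?t\<^sup>2 * s\<^sup>2 / 2"
  proof -
    have "u * (t * (y - x0) - q) = t * (u * y) - (t * x0 + q) * u" for u t q y :: real
      by (simp add: algebra_simps)
    then have eq: "exp (a y) * a y = ?t * (exp (a y) * y) - (?t * x0 + ?t\<^sup>2 * s\<^sup>2 / 2) * exp (a y)" for y
      unfolding a_def .
    have mom: "integrable N (\<lambda>y. exp (a y) * y)" "(\<integral>y. exp (a y) * y \<partial>N) = x0 + ?t * s\<^sup>2"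
      by (rule tilted_moments(3,4)[of ?t, unfolded tilt_a])+
    show "integrable N (\<lambda>y. exp (a y) * a y)" unfolding eq using mom one by simp
    show "(\<integral>y. exp (a y) * a y \<partial>N) = ?t\<^sup>2 * s\<^sup>2 / 2"
      unfolding eq using mom one
      by (simp add: add_divide_distrib algebra_simps power2_eq_square)
  qed
  define e where "e = ?t * x0 + ?t\<^sup>2 * s\<^sup>2 / 2 - ln \<phi>.Z"
  have a_l: "a y - l y = (y - max (min y M) (- M)) / lam - e" for y
    unfolding a_def l_def e_def by (simp add: diff_divide_distrib right_diff_distrib)
  \<comment> \<open>Chebyshev's inequality in its single-crossing form: \<open>a0\<close> is the value of \<open>\<phi>\<close> at a point where
    the two densities agree; this point lies above \<open>M\<close>, below \<open>- M\<close> or in between by the sign of \<open>e\<close>\<close>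
  obtain a0 where cross: "\<And>y. 0 \<le> (\<phi> y - a0) * (exp (a y) - exp (l y))"
  proof -
    consider "0 < e" | "e < 0" | "e = 0" by linarith
    then show ?thesis
    proof cases
      case 1
      have "0 \<le> (\<phi> y - M / lam) * (exp (a y) - exp (l y))" for y
      proof (cases "M \<le> y")
        case False
        then have "(y - max (min y M) (- M)) / lam \<le> 0" using lam_pos by (simp add: divide_le_0_iff)
        then have "a y \<le> l y" using a_l[of y] 1 by linarith
        then show ?thesis using \<phi>_bounds[of y] by (intro mult_nonpos_nonpos) simp_all
      qed (use M_pos in simp)
      then show ?thesis by (rule that)
    next
      case 2
      have "0 \<le> (\<phi> y - - M / lam) * (exp (a y) - exp (l y))" for y
      proof (cases "y \<le> - M")
        case False
        then have "0 \<le> (y - max (min y M) (- M)) / lam" using lam_pos by simp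
        then have "l y \<le> a y" using a_l[of y] 2 by linarith
        then show ?thesis using \<phi>_bounds[of y] by (intro mult_nonneg_nonneg) simp_all
      qed (use M_pos in simp)
      then show ?thesis by (rule that)
    next
      case 3
      have "0 \<le> (\<phi> y - 0) * (exp (a y) - exp (l y))" for y
      proof -
        consider "y < - M" | "- M \<le> y" "y \<le> M" | "M < y" by linarith
        then show ?thesis
        proof cases
          case 1
          then have "max (min y M) (- M) = - M" using M_pos by simp
          then have "a y - l y = (y + M) / lam" "\<phi> y \<le> 0"
            using a_l[of y] \<open>e = 0\<close> M_pos lam_pos by simp_all
          moreover have "(y + M) / lam \<le> 0" using 1 lam_pos by (simp add: divide_le_0_iff)
          ultimately have "a y \<le> l y" "\<phi> y \<le> 0" by linarith+
          then show ?thesis by (intro mult_nonpos_nonpos) simp_all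
        next
          case 2
          then have "a y = l y" using a_l[of y] \<open>e = 0\<close> by simp
          then show ?thesis by simp
        next
          case 3
          then have "max (min y M) (- M) = M" using M_pos by simp
          then have "a y - l y = (y - M) / lam" "0 \<le> \<phi> y"
            using a_l[of y] \<open>e = 0\<close> M_pos lam_pos by simp_all
          moreover have "0 \<le> (y - M) / lam" using 3 lam_pos by simp
          ultimately have "l y \<le> a y" "0 \<le> \<phi> y" by linarith+
          then show ?thesis by (intro mult_nonneg_nonneg) simp_all
        qed
      qed
      then show ?thesis by (rule that)
    qed
  qed
  have expand: "(p - q) * (u - v) = p * u - p * v - q * (u - v)"
      "u * (p - q - v) = p * u - q * u - u * v" for p q u v :: real
    by (simp_all add: algebra_simps)
  have "0 \<le> (\<integral>y. (\<phi> y - a0) * (exp (a y) - exp (l y)) \<partial>N)"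
    using cross by simp
  also have "\<dots> = (\<integral>y. \<phi> y * exp (a y) - \<phi> y * exp (l y) - a0 * (exp (a y) - exp (l y)) \<partial>N)"
    by (simp only: expand(1))
  also have "\<dots> = (\<integral>y. \<phi> y * exp (a y) \<partial>N) - (\<integral>y. \<phi> y * exp (l y) \<partial>N)"
    using int_\<phi> one by simp
  finally have first: "(\<integral>y. \<phi> y * exp (l y) \<partial>N) \<le> (\<integral>y. \<phi> y * exp (a y) \<partial>N)" by simp
  \<comment> \<open>Gibbs' inequality before integration\<close>
  have pt: "\<phi> y * exp (a y) - ln \<phi>.Z * exp (a y) - exp (a y) * a y \<le> exp (l y) - exp (a y)" for y
  proof -
    have "l y - a y \<le> exp (l y - a y) - 1" using exp_ge_add_one_self[of "l y - a y"] by linarith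
    then have "exp (a y) * (l y - a y) \<le> exp (a y) * (exp (l y - a y) - 1)" by (rule mult_left_mono) simp
    also have "\<dots> = exp (l y) - exp (a y)" by (simp add: right_diff_distrib flip: exp_add)
    finally show ?thesis unfolding l_def expand(2) .
  qed
  have "(\<integral>y. \<phi> y * exp (a y) - ln \<phi>.Z * exp (a y) - exp (a y) * a y \<partial>N) \<le> (\<integral>y. exp (l y) - exp (a y) \<partial>N)"
    by (rule integral_mono) (use int_\<phi> int_a one pt in auto)
  also have "\<dots> = 0" using one by simp
  also have "(\<integral>y. \<phi> y * exp (a y) - ln \<phi>.Z * exp (a y) - exp (a y) * a y \<partial>N) =
      (\<integral>y. \<phi> y * exp (a y) \<partial>N) - ln \<phi>.Z * (\<integral>y. exp (a y) \<partial>N) - (\<integral>y. exp (a y) * a y \<partial>N)"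
    using int_\<phi> int_a(1) one(3) by simp
  finally have "(\<integral>y. \<phi> y * exp (a y) \<partial>N) - ln \<phi>.Z \<le> ?t\<^sup>2 * s\<^sup>2 / 2"
    unfolding one(4) int_a(2) by linarith
  then have "(\<integral>y. \<phi> y * exp (l y) \<partial>N) - ln \<phi>.Z \<le> ?t\<^sup>2 * s\<^sup>2 / 2" using first by linarith
  moreover have "(\<integral>y. \<phi> y - ln \<phi>.Z \<partial>\<mu>) = (\<integral>y. \<phi> y * exp (l y) \<partial>N) - ln \<phi>.Z"
  proof -
    have "(\<integral>y. \<phi> y - ln \<phi>.Z \<partial>\<mu>) = (\<integral>y. \<phi> y * exp (l y) - ln \<phi>.Z * exp (l y) \<partial>N)"
      unfolding expl
      by (subst integral_tilted_law, simp, unfold integral_divide_zero[symmetric])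
         (simp only: diff_divide_distrib left_diff_distrib right_diff_distrib times_divide_eq_right mult.commute)
    then show ?thesis using int_\<phi> one by simp
  qed
  ultimately show ?thesis by simp
qed

text \<open>
  The integral of the reward is its mean under the equilibrium, that is \<open>V\<^sub>0\<close> plus \<open>k\<close> times the entropy
  bounded in \<open>tilted_law_entropy\<close>.
\<close>

lemma truncated_reward_cost:
  "(LBINT r:{0..1}. R r) \<le> V0 + k * ((1 / lam)\<^sup>2 * s\<^sup>2 / 2)"
proof -
  obtain b where "rank_reward N (extend_reward R) k b" using truncated_reward_rank by (rule rank_reward_extend)
  then interpret rank_reward N "extend_reward R" k b .
  have "(LBINT r:{0..1}. R r) = (\<integral>y. extend_reward R (cdf \<mu> y) \<partial>\<mu>)"
    unfolding integral_extend_reward[OF truncated_reward_rank, symmetric]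
    by (rule \<mu>.integral_cdf[symmetric]) simp
  also have "\<dots> = (\<integral>y. V0 + k * (\<phi> y - ln \<phi>.Z) \<partial>\<mu>)"
    unfolding extend_truncated_reward by (simp add: algebra_simps)
  also have "\<dots> = V0 + k * (\<integral>y. \<phi> y - ln \<phi>.Z \<partial>\<mu>)"
  proof -
    have "integrable \<mu> \<phi>"
      by (rule \<mu>.integrable_const_bound[where B="M / lam"]) (use \<phi>.bound in simp_all)
    then show ?thesis using \<mu>.prob_space by simp
  qed
  finally show ?thesis
    using mult_left_mono[OF tilted_law_entropy less_imp_le[OF k_pos]] by linarith
qed

text \<open>
  The full tilt has mean \<open>m\<close>, so \<open>y - m\<close> integrates to zero against \<open>exp (y / lam)\<close> and only the difference
  of the weights remains. It vanishes on \<open>[- M, M]\<close>; for \<open>y > M\<close> it is at most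
  \<open>exp (y / lam) \<le> exp (- M / lam) exp (2 y / lam)\<close>, and for \<open>y < - M\<close> at most \<open>exp (- M / lam)\<close>. The
  denominator \<open>\<phi>.Z\<close> is bounded below uniformly in \<open>M\<close> by replacing the exponent with \<open>min y 0 / lam\<close>.
\<close>

lemma truncated_effort_error:
  defines "m \<equiv> x0 + (1 / lam) * s\<^sup>2"
  shows "\<bar>total_effort T \<sigma> c x0 P R - (1 / lam) * s\<^sup>2\<bar> \<le>
    (\<integral>y. \<bar>y - m\<bar> * (exp (2 / lam * y) + 1) \<partial>N) / (\<integral>y. exp (min y 0 / lam) \<partial>N) * exp (- M / lam)"
proof -
  define J where "J = (\<integral>y. \<bar>y - m\<bar> * (exp (2 / lam * y) + 1) \<partial>N)"
  define Z0 where "Z0 = (\<integral>y. exp (min y 0 / lam) \<partial>N)"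
  have lam0: "min y 0 / lam \<le> 0" for y using lam_pos by (simp add: divide_le_0_iff)
  have Z0_int: "integrable N (\<lambda>y. exp (min y 0 / lam))"
    by (rule N.integrable_const_bound[where B=1]) (use lam0 in simp_all)
  have "0 \<le> Z0" unfolding Z0_def by simp
  moreover have "Z0 \<noteq> 0"
  proof
    assume "Z0 = 0"
    then have "AE y in N. exp (min y 0 / lam) = 0"
      unfolding Z0_def using integral_nonneg_eq_0_iff_AE[OF Z0_int] by simp
    then have "AE y in N. False" by simp
    then show False using N.AE_False by simp
  qed
  ultimately have Z0_pos: "0 < Z0" by simp
  have Z0_le: "Z0 \<le> \<phi>.Z"
    unfolding Z0_def
  proof (rule integral_mono[OF Z0_int])
    show "integrable N (\<lambda>y. exp (\<phi> y / 1))" by (rule \<phi>.integrable_exp)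
    show "exp (min y 0 / lam) \<le> exp (\<phi> y / 1)" for y
      using M_pos lam_pos by (auto intro!: divide_right_mono)
  qed
  have e_int: "integrable N (\<lambda>y. exp (y / lam))" "integrable N (\<lambda>y. exp (y / lam) * y)"
    using exponential_moments[of "1 / lam"] by simp_all
  have J_int: "integrable N (\<lambda>y. \<bar>y - m\<bar> * (exp (2 / lam * y) + 1))"
  proof -
    have "integrable N (\<lambda>y. \<bar>exp (2 / lam * y) * y - m * exp (2 / lam * y)\<bar> + \<bar>y - m\<bar>)"
      using exponential_moments[of "2 / lam"] reference_moments
      by (intro Bochner_Integration.integrable_add integrable_abs Bochner_Integration.integrable_diff) simp_all
    moreover have "\<bar>u * y - m * u\<bar> + \<bar>y - m\<bar> = \<bar>y - m\<bar> * (u + 1)" if "0 \<le> u" for u y :: real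
    proof -
      have "u * y - m * u = u * (y - m)" by (simp add: algebra_simps)
      then have "\<bar>u * y - m * u\<bar> = u * \<bar>y - m\<bar>" using that by (simp add: abs_mult)
      then show ?thesis by (simp add: distrib_left)
    qed
    ultimately show ?thesis by simp
  qed
  have zero: "(\<integral>y. exp (y / lam) * (y - m) \<partial>N) = 0"
  proof -
    have "exp (y / lam) * (y - m) =
        exp ((1 / lam) * x0 + (1 / lam)\<^sup>2 * s\<^sup>2 / 2) * (tilt (1 / lam) y * y - m * tilt (1 / lam) y)" for y
    proof -
      have "exp (y / lam) = exp ((1 / lam) * x0 + (1 / lam)\<^sup>2 * s\<^sup>2 / 2) * tilt (1 / lam) y"
        by (simp add: diff_divide_distrib flip: exp_add)
      then show ?thesis by (simp only: algebra_simps)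
    qed
    then show ?thesis
      using tilted_moments[of "1 / lam"] by (simp add: m_def del: power_mult_distrib)
  qed
  have err: "\<bar>exp (\<phi> y) - exp (y / lam)\<bar> \<le> exp (- M / lam) * (exp (2 / lam * y) + 1)" for y
  proof -
    consider "y < - M" | "- M \<le> y" "y \<le> M" | "M < y" by linarith
    then show ?thesis
    proof cases
      case 1
      then have \<phi>: "\<phi> y = - M / lam" using M_pos by simp
      have "exp (y / lam) \<le> exp (- M / lam)" 
        using divide_right_mono[of y "- M" lam] 1 lam_pos by simp
      then have "\<bar>exp (\<phi> y) - exp (y / lam)\<bar> \<le> exp (- M / lam)"
        unfolding \<phi> using exp_gt_zero[of "y / lam"] by linarith
      also have "\<dots> \<le> exp (- M / lam) * (exp (2 / lam * y) + 1)" by simp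
      finally show ?thesis .
    next
      case 2
      then show ?thesis by simp
    next
      case 3
      then have \<phi>: "\<phi> y = M / lam" using M_pos by simp
      have "exp (M / lam) \<le> exp (y / lam)" using 3 lam_pos by (simp add: divide_le_cancel)
      then have "\<bar>exp (\<phi> y) - exp (y / lam)\<bar> \<le> exp (y / lam)"
        unfolding \<phi> using exp_gt_zero[of "M / lam"] by linarith
      also have "\<dots> \<le> exp (- M / lam + 2 / lam * y)"
        using 3 lam_pos by (simp add: field_simps)
      also have "\<dots> = exp (- M / lam) * exp (2 / lam * y)" by (rule exp_add)
      also have "\<dots> \<le> exp (- M / lam) * (exp (2 / lam * y) + 1)"
        by (simp add: distrib_left)
      finally show ?thesis .
    qed
  qed
  have ym_int: "integrable N (\<lambda>y. y - m)" using reference_moments by simp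
  have e_ym_int: "integrable N (\<lambda>y. exp (y / lam) * (y - m))"
    using e_int by (simp add: right_diff_distrib)
  have "total_effort T \<sigma> c x0 P R - (1 / lam) * s\<^sup>2 = (\<integral>y. y - m \<partial>\<mu>)"
  proof -
    have "integrable \<mu> (\<lambda>y. y)"
      unfolding tilted_law_gibbs gibbs_law_def
      using integrable_exp_\<phi>[OF reference_moments(1)] \<phi>.Z_pos by (subst integrable_density) simp_all
    then show ?thesis
      unfolding total_effort_def truncated_equilibrium m_def using \<mu>.prob_space by simp
  qed
  also have "\<dots> = (\<integral>y. (exp (\<phi> y) - exp (y / lam)) * (y - m) \<partial>N) / \<phi>.Z"
    using integrable_exp_\<phi>[OF ym_int] e_ym_int zero
    by (subst integral_tilted_law) (simp_all add: left_diff_distrib)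
  finally have eq: "total_effort T \<sigma> c x0 P R - (1 / lam) * s\<^sup>2 =
    (\<integral>y. (exp (\<phi> y) - exp (y / lam)) * (y - m) \<partial>N) / \<phi>.Z" .
  have "\<bar>\<integral>y. (exp (\<phi> y) - exp (y / lam)) * (y - m) \<partial>N\<bar> \<le>
      (\<integral>y. exp (- M / lam) * (\<bar>y - m\<bar> * (exp (2 / lam * y) + 1)) \<partial>N)"
  proof (rule integral_abs_bound[THEN order_trans], rule integral_mono)
    show "integrable N (\<lambda>y. \<bar>(exp (\<phi> y) - exp (y / lam)) * (y - m)\<bar>)"
      unfolding left_diff_distrib using integrable_exp_\<phi>[OF ym_int] e_ym_int
      by (intro integrable_abs Bochner_Integration.integrable_diff)
    show "integrable N (\<lambda>y. exp (- M / lam) * (\<bar>y - m\<bar> * (exp (2 / lam * y) + 1)))"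
      by (intro integrable_mult_right J_int)
    show "\<bar>(exp (\<phi> y) - exp (y / lam)) * (y - m)\<bar> \<le> exp (- M / lam) * (\<bar>y - m\<bar> * (exp (2 / lam * y) + 1))" for y
      unfolding abs_mult using mult_right_mono[OF err[of y] abs_ge_zero[of "y - m"]] by (simp only: ac_simps)
  qed
  also have "\<dots> = exp (- M / lam) * J" unfolding J_def by simp
  finally have num: "\<bar>\<integral>y. (exp (\<phi> y) - exp (y / lam)) * (y - m) \<partial>N\<bar> \<le> exp (- M / lam) * J" .
  have "\<bar>total_effort T \<sigma> c x0 P R - (1 / lam) * s\<^sup>2\<bar> \<le> (exp (- M / lam) * J) / Z0"
    unfolding eq abs_divide using num Z0_pos Z0_le by (intro frac_le) simp_all
  also have "exp (- M / lam) * J / Z0 = J / Z0 * exp (- M / lam)" by simp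
  finally show ?thesis unfolding J_def Z0_def .
qed

end

section \<open>The optimal total effort\<close>

theorem theorem5p4:
  fixes T \<sigma> c x0 V0 K :: real
    and W :: "'w measure" and B :: "real \<Rightarrow> 'w \<Rightarrow> real"
    and P :: "(real \<Rightarrow> real) measure"
  assumes "0 < T" and "0 < \<sigma>" and "0 < c"
    and "std_brownian_motion W T B"
    and "P = reference_law T \<sigma> x0 W B"
    and "V0 \<le> K"
  shows "(SUP R\<in>feasible_rewards T \<sigma> c P V0 K. ereal (total_effort T \<sigma> c x0 P R))
            = ereal (sqrt ((K - V0) * T / c)) \<and>
         (K = V0 \<longrightarrow>
            optimal_reward T \<sigma> c x0 P V0 K (\<lambda>_. V0) \<and>
            (\<forall>R. optimal_reward T \<sigma> c x0 P V0 K R \<longrightarrow> (AE r in lborel. r \<in> {0..1} \<longrightarrow> R r = V0))) \<and>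
         (V0 < K \<longrightarrow>
            (let lam = \<sigma>\<^sup>2 * sqrt (c * T / (K - V0)) in
               (\<forall>\<^sub>F M in at_top.
                  truncated_reward T \<sigma> c x0 V0 lam M \<in> feasible_rewards T \<sigma> c P V0 K) \<and>
               (\<lambda>M. total_effort T \<sigma> c x0 P (truncated_reward T \<sigma> c x0 V0 lam M)
                      - sqrt ((K - V0) * T / c))
                 \<in> O[at_top](\<lambda>M. exp (- M / lam))))"
proof -
  interpret contest P T \<sigma> c x0
    unfolding assms(5) using assms(1-4) by (rule contest_reference_law)
  let ?F = "feasible_rewards T \<sigma> c P V0 K" and ?A = "total_effort T \<sigma> c x0 P"
  define q where "q = sqrt ((K - V0) * T / c)"
  have upper: "(SUP R\<in>?F. ereal (?A R)) \<le> ereal q"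
    unfolding q_def using effort_le[OF _ \<open>V0 \<le> K\<close>] by (intro SUP_least) simp
  show ?thesis
  proof (cases "K = V0")
    case True
    have q0: "q = 0" by (simp add: q_def True)
    have const: "(\<lambda>_. V0) \<in> ?F" "?A (\<lambda>_. V0) = 0"
      using constant_reward True by simp_all
    have "ereal 0 \<le> (SUP R\<in>?F. ereal (?A R))"
      using SUP_upper[OF const(1), of "\<lambda>R. ereal (?A R)"] const(2) by simp
    then have sup: "(SUP R\<in>?F. ereal (?A R)) = ereal q"
      using upper q0 by (intro antisym) simp_all
    have "optimal_reward T \<sigma> c x0 P V0 K (\<lambda>_. V0)"
      using const effort_le[OF _ \<open>V0 \<le> K\<close>] True by (simp add: optimal_reward_def)
    moreover have "AE r in lborel. r \<in> {0..1} \<longrightarrow> R r = V0"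
      if "optimal_reward T \<sigma> c x0 P V0 K R" for R
      using that feasible_tight True by (simp add: optimal_reward_def)
    ultimately show ?thesis using sup True by (simp add: q_def)
  next
    case False
    then have gap: "0 < K - V0" using \<open>V0 \<le> K\<close> by simp
    have q: "0 < q" "q\<^sup>2 = (K - V0) * T / c"
      using gap T_pos c_pos by (simp_all add: q_def)
    define lam where "lam = \<sigma>\<^sup>2 * sqrt (c * T / (K - V0))"
    have "c * T / (K - V0) = (T / q)\<^sup>2"
      unfolding power_divide q(2) using gap T_pos c_pos by (simp add: field_simps power2_eq_square)
    then have lam: "lam = \<sigma>\<^sup>2 * T / q"
      unfolding lam_def using T_pos q(1) by simp
    have lam_pos: "0 < lam" unfolding lam using T_pos \<sigma>_pos q(1) by simp
    \<comment> \<open>the tilt with parameter \<open>1 / lam\<close> displaces the mean by \<open>q\<close> and exhausts the budget exactly\<close>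
    have drift: "1 / lam * s\<^sup>2 = q"
      unfolding s_squared lam using T_pos \<sigma>_pos q(1) by (simp add: field_simps)
    have "k * ((1 / lam)\<^sup>2 * s\<^sup>2 / 2) = c * q\<^sup>2 / T"
      unfolding s_squared lam using T_pos \<sigma>_pos q(1) by (simp add: field_simps power2_eq_square)
    then have budget: "k * ((1 / lam)\<^sup>2 * s\<^sup>2 / 2) = K - V0"
      unfolding q(2) using T_pos c_pos by simp
    let ?R = "truncated_reward T \<sigma> c x0 V0 lam"
    define m where "m = x0 + 1 / lam * s\<^sup>2"
    define C where "C = (\<integral>y. \<bar>y - m\<bar> * (exp (2 / lam * y) + 1) \<partial>N) / (\<integral>y. exp (min y 0 / lam) \<partial>N)"
    have each: "?R M \<in> ?F \<and> \<bar>?A (?R M) - q\<bar> \<le> C * exp (- M / lam)" if "0 < M" for M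
    proof -
      interpret truncated_contest P T \<sigma> c x0 lam M V0
        by standard (rule lam_pos that)+
      have "(LBINT r:{0..1}. ?R M r) \<le> K"
        using truncated_reward_cost unfolding budget by simp
      then have "?R M \<in> ?F"
        using truncated_reward_rank truncated_game_value by (simp add: feasible_rewards_def)
      moreover have "\<bar>?A (?R M) - q\<bar> \<le> C * exp (- M / lam)"
        using truncated_effort_error unfolding C_def m_def drift .
      ultimately show ?thesis ..
    qed
    have feas: "\<forall>\<^sub>F M in at_top. ?R M \<in> ?F"
      using eventually_gt_at_top[of "0::real"] by eventually_elim (use each in blast)
    have err: "\<forall>\<^sub>F M in at_top. norm (?A (?R M) - q) \<le> C * norm (exp (- M / lam))"
      using eventually_gt_at_top[of "0::real"] by eventually_elim (use each in simp)
    have bigo: "(\<lambda>M. ?A (?R M) - q) \<in> O[at_top](\<lambda>M. exp (- M / lam))"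
      using err by (rule bigoI)
    have "((\<lambda>M. exp (- M / lam)) \<longlongrightarrow> 0) at_top"
      using lam_pos by real_asymp
    then have "((\<lambda>M. C * norm (exp (- M / lam))) \<longlongrightarrow> 0) at_top"
      using tendsto_mult_right_zero by fastforce
    then have "((\<lambda>M. ?A (?R M) - q) \<longlongrightarrow> 0) at_top"
      using err by (rule Lim_null_comparison[rotated])
    then have "((\<lambda>M. ?A (?R M)) \<longlongrightarrow> q) at_top"
      by (simp add: LIM_zero_iff)
    then have "((\<lambda>M. ereal (?A (?R M))) \<longlongrightarrow> ereal q) at_top"
      by (rule tendsto_ereal)
    moreover have "\<forall>\<^sub>F M in at_top. ereal (?A (?R M)) \<le> (SUP R\<in>?F. ereal (?A R))"
      using feas by eventually_elim (rule SUP_upper)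
    ultimately have "ereal q \<le> (SUP R\<in>?F. ereal (?A R))"
      by (rule tendsto_upperbound) simp
    then have "(SUP R\<in>?F. ereal (?A R)) = ereal q"
      using upper by (rule antisym[rotated])
    then show ?thesis
      using feas bigo False by (simp add: Let_def q_def lam_def)
  qed
qed

end
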